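(* Let $d\in\mathbb N$ and let $\mu_0$ be a probability measure on $\mathbb R^d$ with Lebesgue density $\pi_0$; set $S_0=\{\pi_0>0\}$. For each $n\in\mathbb N$ let $\Phi_n:S_0\to\mathbb R$ with $Z_n=\int_{S_0}\exp(-n\Phi_n)\,d\mu_0\in(0,\infty)$, $\mu_n(dx)=Z_n^{-1}\exp(-n\Phi_n(x))\mu_0(dx)$ and $I_n=\Phi_n-\frac1n\log\pi_0$ on $S_0$. Assume: (A1) For every $n$, $\Phi_n,\pi_0\in C^2(S_0,\mathbb R)$, and $I_n$ has a unique minimizer $x_n\in S_0$ with $I_n(x_n)=0$, $\nabla I_n(x_n)=0$, $\nabla^2I_n(x_n)$ positive definite. (A2) $\Phi_n,\pi_0\in C^3(S_0,\mathbb R)$ for all $n$, and (i) $x_\star=\lim x_n$ and $H_\star=\lim\nabla^2\Phi_n(x_n)$ exist, $H_\star$ is positive definite, $x_\star$ is in the interior of $S_0$; (ii) for each $r>0$ there exist $n_r$, $\delta_r>0$, $K_r<\infty$ such that for all $n\ge n_r$: $I_n(x)\ge\delta_r$ for all $x\in S_0$ with $\|x-x_n\|>r$, and $\|\nabla^3\log\pi_0(x)\|\le K_r$, $\|\nabla^3\Phi_n(x)\|\le K_r$ for all $x\in S_0$ with $\|x\|\le r$; (iii) there exist $n_0$, $\epsilon\in(0,1)$ and $q:S_0\to[0,\infty)$ with $\exp(-nI_n(x))\le q(x)$ for all $x\in S_0$, $n\ge n_0$, and $\int_{S_0}q^{1-\epsilon}\,dx<\infty$. Let $C_n^{-1}=\nabla^2I_n(x_n)$,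 $\mathcal L_{\mu_n}=\mathcal N(x_n,n^{-1}C_n)$, and define $\pi_n(x)=\exp(-n\Phi_n(x))\pi_0(x)$ for $x\in S_0$, $\pi_n(x)=0$ otherwise, and $\tilde\pi_n(x)=\exp\!\big(-\frac n2(x-x_n)^\top C_n^{-1}(x-x_n)\big)$ for $x\in\mathbb R^d$. Then for every $p\in\mathbb N$, $$\int_{\mathbb R^d}\Big|\Big(\frac{\pi_n(x)}{\tilde\pi_n(x)}\Big)^{1/p}-1\Big|^p\,\mathcal L_{\mu_n}(dx)\in\mathcal O(n^{-p/2})\quad(n\to\infty).$$ *)

theory Defs
  imports "HOL-Analysis.Analysis" "HOL-Library.Landau_Symbols"
begin

text \<open>Frechet derivative as a bounded linear operator, so that it can be iterated:
  Df x : 'a =>L 'b,  D(D f) x : 'a =>L ('a =>L 'b) (Hessian as bilinear form), etc.\<close>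
definition Dfr :: "('a::real_normed_vector \<Rightarrow> 'b::real_normed_vector) \<Rightarrow> 'a \<Rightarrow> ('a \<Rightarrow>\<^sub>L 'b)" where
  "Dfr f x = Blinfun (frechet_derivative f (at x))"

definition C2_on :: "'a::real_normed_vector set \<Rightarrow> ('a \<Rightarrow> real) \<Rightarrow> bool" where
  "C2_on U f \<longleftrightarrow> open U \<and> (\<forall>x\<in>U. f differentiable (at x)) \<and>
     (\<forall>x\<in>U. Dfr f differentiable (at x)) \<and> continuous_on U (Dfr (Dfr f))"

definition C3_on :: "'a::real_normed_vector set \<Rightarrow> ('a \<Rightarrow> real) \<Rightarrow> bool" where
  "C3_on U f \<longleftrightarrow> C2_on U f \<and> (\<forall>x\<in>U. Dfr (Dfr f) differentiable (at x)) \<and>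
     continuous_on U (Dfr (Dfr (Dfr f)))"

definition pos_def_form :: "('a::real_normed_vector \<Rightarrow>\<^sub>L 'a \<Rightarrow>\<^sub>L real) \<Rightarrow> bool" where
  "pos_def_form H \<longleftrightarrow> (\<forall>v. v \<noteq> 0 \<longrightarrow> blinfun_apply (blinfun_apply H v) v > 0)"

end

theory Submission
  imports Defs
begin

(*
  Write pi_n = exp (-n I_n) on S0 and let A_n be the Hessian of I_n at x_n, so that the Gaussian
  weight is exp (-n/2 A_n(h,h)) with h = x - x_n.  Since A_n converges to a positive definite
  limit, lam |h|^2 <= A_n(h,h) <= Lam |h|^2 uniformly for large n; since the third derivatives
  are bounded near x_star, |I_n(x_n + h) - A_n(h,h)/2| <= K |h|^3 on a ball |h| < rho with
  K rho <= lam/4.  Multiplying the integrand by the unnormalised Gaussian weight: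
  - on the ball, the log-ratio R satisfies |R| <= n K |h|^3 <= n lam |h|^2 / 4, and
    |e^(-R/p) - 1|^p <= |R|^p e^|R| bounds the contribution by (nK)^p |h|^(3p) e^(-n lam |h|^2/4),
    whose integral is O(n^(-(d+p)/2));
  - off the ball, b |(a/b)^(1/p) - 1|^p <= a + b, the Gaussian is at most
    e^(-n lam rho^2/4) e^(-n lam |h|^2/4), and pi_n <= e^(-n eps delta) q^(1-eps) by the
    tail bound I_n >= delta and the integrable majorant q, so both are exponentially small.
  The normalising constant is at least of order n^(-d/2), which gives O(n^(-p/2)).
*)

lemma Dfr_eq_Blinfun: "(f has_derivative f') (at x) \<Longrightarrow> Dfr f x = Blinfun f'"
  unfolding Dfr_def using frechet_derivative_at by metis

lemma blinfun_apply_Dfr: "(f has_derivative f') (at x) \<Longrightarrow> blinfun_apply (Dfr f x) = f'"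
  by (simp add: Dfr_eq_Blinfun bounded_linear_Blinfun_apply has_derivative_bounded_linear)

lemma has_derivative_Dfr: "f differentiable at x \<Longrightarrow> (f has_derivative blinfun_apply (Dfr f x)) (at x)"
  by (metis blinfun_apply_Dfr frechet_derivative_works)

lemma Dfr_cong_open:
  assumes "open U" "x \<in> U" "\<And>y. y \<in> U \<Longrightarrow> f y = g y"
  shows "Dfr f x = Dfr g x"
proof -
  have "(\<lambda>f'. (f has_derivative f') (at x)) = (\<lambda>f'. (g has_derivative f') (at x))"
    using assms by (intro ext iffI) (auto intro: has_derivative_transform_within_open)
  then show ?thesis unfolding Dfr_def frechet_derivative_def by simp
qed

lemma differentiable_at_cong_open:
  assumes "f differentiable at x" "open U" "x \<in> U" "\<And>y. y \<in> U \<Longrightarrow> f y = g y"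
  shows "g differentiable at x"
  using assms unfolding differentiable_def
  by (meson has_derivative_transform_within_open)

lemma Dfr_diff_scaleR:
  fixes f g :: "'a::real_normed_vector \<Rightarrow> 'b::real_normed_vector"
  assumes "f differentiable at x" "g differentiable at x"
  shows "Dfr (\<lambda>z. f z - c *\<^sub>R g z) x = Dfr f x - c *\<^sub>R Dfr g x"
    and "(\<lambda>z. f z - c *\<^sub>R g z) differentiable at x"
proof -
  have d: "((\<lambda>z. f z - c *\<^sub>R g z) has_derivative (\<lambda>h. Dfr f x h - c *\<^sub>R Dfr g x h)) (at x)"
    using has_derivative_Dfr[OF assms(1)] has_derivative_Dfr[OF assms(2)]
    by (intro derivative_intros) auto
  show "Dfr (\<lambda>z. f z - c *\<^sub>R g z) x = Dfr f x - c *\<^sub>R Dfr g x"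
    by (rule blinfun_eqI) (simp add: blinfun_apply_Dfr[OF d] blinfun.diff_left blinfun.scaleR_left)
  show "(\<lambda>z. f z - c *\<^sub>R g z) differentiable at x"
    using d by (rule differentiableI)
qed

lemma Dfr_diff_scaleR_on:
  fixes f g :: "'a::real_normed_vector \<Rightarrow> 'b::real_normed_vector"
  assumes "open U" "x \<in> U" "\<And>z. z \<in> U \<Longrightarrow> F z = f z - c *\<^sub>R g z"
    and "f differentiable at x" "g differentiable at x"
  shows "Dfr F x = Dfr f x - c *\<^sub>R Dfr g x" and "F differentiable at x"
  using Dfr_cong_open[OF assms(1-3)] Dfr_diff_scaleR[OF assms(4,5)]
    differentiable_at_cong_open[OF _ assms(1,2), of "\<lambda>z. f z - c *\<^sub>R g z" F] assms(3)
  by auto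

definition thrice_differentiable_on :: "'a::real_normed_vector set \<Rightarrow> ('a \<Rightarrow> real) \<Rightarrow> bool" where
  "thrice_differentiable_on U f \<longleftrightarrow> open U \<and> (\<forall>y\<in>U. f differentiable at y \<and>
      Dfr f differentiable at y \<and> Dfr (Dfr f) differentiable at y)"

lemma C3_on_imp_thrice_differentiable_on: "C3_on U f \<Longrightarrow> thrice_differentiable_on U f"
  unfolding C3_on_def C2_on_def thrice_differentiable_on_def by auto

lemma thrice_differentiable_on_diff_scaleR:
  fixes f g :: "'a::real_normed_vector \<Rightarrow> real" and c :: real
  assumes f: "thrice_differentiable_on U f" and g: "thrice_differentiable_on U g"
  defines "h \<equiv> \<lambda>z. f z - c *\<^sub>R g z"
  shows "thrice_differentiable_on U h"
    and "\<And>y. y \<in> U \<Longrightarrow> Dfr (Dfr h) y = Dfr (Dfr f) y - c *\<^sub>R Dfr (Dfr g) y"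
    and "\<And>y. y \<in> U \<Longrightarrow> Dfr (Dfr (Dfr h)) y = Dfr (Dfr (Dfr f)) y - c *\<^sub>R Dfr (Dfr (Dfr g)) y"
proof -
  have U: "open U" using f unfolding thrice_differentiable_on_def by blast
  have fd: "f differentiable at y" "Dfr f differentiable at y" "Dfr (Dfr f) differentiable at y"
    and gd: "g differentiable at y" "Dfr g differentiable at y" "Dfr (Dfr g) differentiable at y"
    if "y \<in> U" for y
    using f g that unfolding thrice_differentiable_on_def by blast+
  have D1: "Dfr h y = Dfr f y - c *\<^sub>R Dfr g y" "h differentiable at y" if "y \<in> U" for y
    unfolding h_def by (rule Dfr_diff_scaleR[OF fd(1)[OF that] gd(1)[OF that]])+
  have D2: "Dfr (Dfr h) y = Dfr (Dfr f) y - c *\<^sub>R Dfr (Dfr g) y" "Dfr h differentiable at y"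
    if "y \<in> U" for y
    using Dfr_diff_scaleR_on[OF U that D1(1) fd(2) gd(2)] that by auto
  have D3: "Dfr (Dfr (Dfr h)) y = Dfr (Dfr (Dfr f)) y - c *\<^sub>R Dfr (Dfr (Dfr g)) y"
    "Dfr (Dfr h) differentiable at y" if "y \<in> U" for y
    using Dfr_diff_scaleR_on[OF U that D2(1) fd(3) gd(3)] that by auto
  show "thrice_differentiable_on U h"
    unfolding thrice_differentiable_on_def using U D1(2) D2(2) D3(2) by blast
  show "\<And>y. y \<in> U \<Longrightarrow> Dfr (Dfr h) y = Dfr (Dfr f) y - c *\<^sub>R Dfr (Dfr g) y"
    using D2(1) by blast
  show "\<And>y. y \<in> U \<Longrightarrow> Dfr (Dfr (Dfr h)) y = Dfr (Dfr (Dfr f)) y - c *\<^sub>R Dfr (Dfr (Dfr g)) y"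
    using D3(1) by blast
qed

lemma differentiable_log_hessian:
  fixes P :: "'a::real_normed_vector \<Rightarrow> real"
  assumes "P differentiable at y" "Dfr P differentiable at y" "Dfr (Dfr P) differentiable at y"
    and "P y \<noteq> 0"
  shows "(\<lambda>z. inverse (P z) *\<^sub>R Dfr (Dfr P) z -
      (inverse (P z) * inverse (P z)) *\<^sub>R (blinfun_scaleR_left (Dfr P z) o\<^sub>L Dfr P z)) differentiable at y"
proof -
  have "((\<lambda>z. blinfun_scaleR_left (Dfr P z) o\<^sub>L Dfr P z) has_derivative
     (\<lambda>h. (blinfun_scaleR_left (Dfr P y) o\<^sub>L Dfr (Dfr P) y h) +
          (blinfun_scaleR_left (Dfr (Dfr P) y h) o\<^sub>L Dfr P y))) (at y)"
    using has_derivative_Dfr[OF assms(2)]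
    by (intro bounded_bilinear.FDERIV[OF bounded_bilinear_blinfun_compose]
        bounded_linear.has_derivative[OF bounded_linear_blinfun_scaleR_left])
  then have "(\<lambda>z. blinfun_scaleR_left (Dfr P z) o\<^sub>L Dfr P z) differentiable at y"
    by (rule differentiableI)
  moreover have "(\<lambda>z. inverse (P z)) differentiable at y"
    using assms(1,4) by (intro differentiable_inverse)
  ultimately show ?thesis
    using assms by (intro differentiable_diff differentiable_scaleR differentiable_mult) auto
qed

lemma thrice_differentiable_on_ln:
  fixes P :: "'a::real_normed_vector \<Rightarrow> real"
  assumes P: "thrice_differentiable_on U P" and pos: "\<And>y. y \<in> U \<Longrightarrow> P y > 0"
  shows "thrice_differentiable_on U (\<lambda>z. ln (P z))"
proof -
  have U: "open U" using P unfolding thrice_differentiable_on_def by blast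
  have Pd: "P differentiable at y" "Dfr P differentiable at y" "Dfr (Dfr P) differentiable at y"
    if "y \<in> U" for y
    using P that unfolding thrice_differentiable_on_def by blast+
  define E1 where "E1 = (\<lambda>z. inverse (P z) *\<^sub>R Dfr P z)"
  define E2 where "E2 = (\<lambda>z. inverse (P z) *\<^sub>R Dfr (Dfr P) z -
      (inverse (P z) * inverse (P z)) *\<^sub>R (blinfun_scaleR_left (Dfr P z) o\<^sub>L Dfr P z))"
  have d0: "((\<lambda>z. ln (P z)) has_derivative (\<lambda>h. Dfr P y h * inverse (P y))) (at y)" if "y \<in> U" for y
    using has_derivative_Dfr[OF Pd(1)[OF that]] pos[OF that] by (intro has_derivative_ln) auto
  have D1: "Dfr (\<lambda>z. ln (P z)) y = E1 y" if "y \<in> U" for y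
    unfolding E1_def
    by (rule blinfun_eqI) (simp add: blinfun_apply_Dfr[OF d0[OF that]] blinfun.scaleR_left)
  have d1: "(E1 has_derivative (\<lambda>h. inverse (P y) *\<^sub>R Dfr (Dfr P) y h -
      (inverse (P y) * Dfr P y h * inverse (P y)) *\<^sub>R Dfr P y)) (at y)" if "y \<in> U" for y
    unfolding E1_def
    using has_derivative_Dfr[OF Pd(1)[OF that]] has_derivative_Dfr[OF Pd(2)[OF that]] pos[OF that]
    by (auto intro!: derivative_eq_intros)
  have D2: "Dfr E1 y = E2 y" if "y \<in> U" for y
    unfolding E2_def
    by (rule blinfun_eqI) (simp add: blinfun_apply_Dfr[OF d1[OF that]] blinfun.diff_left
        scaleR_scaleR blinfun.scaleR_left algebra_simps)
  have E2_diff: "E2 differentiable at y" if "y \<in> U" for y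
    unfolding E2_def using Pd[OF that] pos[OF that] by (intro differentiable_log_hessian) auto
  have E1_diff: "E1 differentiable at y" if "y \<in> U" for y
    using d1[OF that] by (rule differentiableI)
  have "Dfr (\<lambda>z. ln (P z)) differentiable at y" if "y \<in> U" for y
    by (rule differentiable_at_cong_open[OF E1_diff[OF that] U that]) (simp add: D1)
  moreover have "Dfr (Dfr (\<lambda>z. ln (P z))) differentiable at y" if "y \<in> U" for y
  proof (rule differentiable_at_cong_open[OF E2_diff[OF that] U that])
    show "E2 z = Dfr (Dfr (\<lambda>z. ln (P z))) z" if "z \<in> U" for z
      using Dfr_cong_open[OF U that D1] D2[OF that] by simp
  qed
  moreover have "(\<lambda>z. ln (P z)) differentiable at y" if "y \<in> U" for y
    using d0[OF that] by (rule differentiableI)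
  ultimately show ?thesis unfolding thrice_differentiable_on_def using U by blast
qed

lemma thrice_differentiable_on_imp_continuous_on:
  "thrice_differentiable_on U f \<Longrightarrow> continuous_on U f"
  unfolding thrice_differentiable_on_def
  by (intro continuous_at_imp_continuous_on) (auto intro: differentiable_imp_continuous_within)

lemma thrice_differentiable_on_isCont_Dfr2:
  "thrice_differentiable_on U f \<Longrightarrow> x \<in> U \<Longrightarrow> isCont (Dfr (Dfr f)) x"
  unfolding thrice_differentiable_on_def by (auto intro: differentiable_imp_continuous_within)

lemma thrice_differentiable_on_log_potential:
  fixes \<Phi> \<pi> :: "'a::real_normed_vector \<Rightarrow> real" and c :: real
  assumes "C3_on S \<Phi>" "C3_on S \<pi>" "\<And>y. y \<in> S \<Longrightarrow> \<pi> y > 0"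
  shows "thrice_differentiable_on S (\<lambda>z. \<Phi> z - c * ln (\<pi> z))"
    and "\<And>y. y \<in> S \<Longrightarrow> Dfr (Dfr (\<lambda>z. \<Phi> z - c * ln (\<pi> z))) y =
      Dfr (Dfr \<Phi>) y - c *\<^sub>R Dfr (Dfr (\<lambda>z. ln (\<pi> z))) y"
    and "\<And>y. y \<in> S \<Longrightarrow> Dfr (Dfr (Dfr (\<lambda>z. \<Phi> z - c * ln (\<pi> z)))) y =
      Dfr (Dfr (Dfr \<Phi>)) y - c *\<^sub>R Dfr (Dfr (Dfr (\<lambda>z. ln (\<pi> z)))) y"
  using thrice_differentiable_on_diff_scaleR[OF C3_on_imp_thrice_differentiable_on[OF assms(1)]
      thrice_differentiable_on_ln[OF C3_on_imp_thrice_differentiable_on[OF assms(2)] assms(3)], where c = c]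
  by simp_all

section \<open>Third-order Taylor bound\<close>

lemma has_real_derivative_along_line:
  fixes F :: "'a::real_normed_vector \<Rightarrow> 'b::real_normed_vector"
  assumes "F differentiable at (x + t *\<^sub>R h)" "bounded_linear L"
  shows "((\<lambda>t. L (F (x + t *\<^sub>R h))) has_real_derivative (L (Dfr F (x + t *\<^sub>R h) h))) (at t)"
proof -
  have "((\<lambda>t. x + t *\<^sub>R h) has_derivative (\<lambda>s. s *\<^sub>R h)) (at t)"
    by (intro derivative_eq_intros) auto
  from has_derivative_compose[OF this has_derivative_Dfr[OF assms(1)]]
  have "((\<lambda>t. L (F (x + t *\<^sub>R h))) has_derivative (\<lambda>s. L (Dfr F (x + t *\<^sub>R h) (s *\<^sub>R h)))) (at t)"
    by (intro bounded_linear.has_derivative[OF assms(2)]) (simp add: o_def)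
  moreover have "(\<lambda>s. L (Dfr F (x + t *\<^sub>R h) (s *\<^sub>R h))) = (*) (L (Dfr F (x + t *\<^sub>R h) h))"
    by (rule ext) (simp add: blinfun.scaleR_right linear_scale[OF bounded_linear.linear[OF assms(2)]])
  ultimately show ?thesis unfolding has_field_derivative_def by simp
qed

lemma norm_blinfun_apply2_le:
  fixes B :: "'a::real_normed_vector \<Rightarrow>\<^sub>L 'a \<Rightarrow>\<^sub>L real"
  shows "\<bar>B v v\<bar> \<le> norm B * norm v ^ 2"
proof -
  have "norm (B v v) \<le> norm (B v) * norm v" by (rule norm_blinfun)
  also have "\<dots> \<le> (norm B * norm v) * norm v" by (intro mult_right_mono norm_blinfun) auto
  finally show ?thesis by (simp add: power2_eq_square mult_ac)
qed

lemma norm_blinfun_apply3_le: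
  fixes B :: "'a::real_normed_vector \<Rightarrow>\<^sub>L 'a \<Rightarrow>\<^sub>L 'a \<Rightarrow>\<^sub>L real"
  shows "\<bar>B v v v\<bar> \<le> norm B * norm v ^ 3"
proof -
  have "\<bar>B v v v\<bar> \<le> norm (B v) * norm v ^ 2" by (rule norm_blinfun_apply2_le)
  also have "\<dots> \<le> (norm B * norm v) * norm v ^ 2" by (intro mult_right_mono norm_blinfun) auto
  finally show ?thesis by (simp add: power3_eq_cube power2_eq_square mult_ac)
qed

lemma third_order_taylor_bound:
  fixes f :: "'a::real_normed_vector \<Rightarrow> real"
  assumes f: "thrice_differentiable_on U f" and seg: "\<And>t. 0 \<le> t \<Longrightarrow> t \<le> 1 \<Longrightarrow> x + t *\<^sub>R h \<in> U"
    and bnd: "\<And>t. 0 \<le> t \<Longrightarrow> t \<le> 1 \<Longrightarrow> norm (Dfr (Dfr (Dfr f)) (x + t *\<^sub>R h)) \<le> K"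
  shows "\<bar>f (x + h) - f x - Dfr f x h - Dfr (Dfr f) x h h / 2\<bar> \<le> K * norm h ^ 3 / 6"
proof -
  define diff where "diff = (\<lambda>(m::nat) (t::real). if m = 0 then f (x + t *\<^sub>R h)
     else if m = 1 then Dfr f (x + t *\<^sub>R h) h
     else if m = 2 then Dfr (Dfr f) (x + t *\<^sub>R h) h h else Dfr (Dfr (Dfr f)) (x + t *\<^sub>R h) h h h)"
  have bl1: "bounded_linear (\<lambda>B::'a \<Rightarrow>\<^sub>L real. B h)" by simp
  have bl2: "bounded_linear (\<lambda>B::'a \<Rightarrow>\<^sub>L 'a \<Rightarrow>\<^sub>L real. B h h)"
    using bounded_linear_compose[OF bl1 bounded_linear_apply_blinfun[of h]] by (simp add: o_def)
  have "DERIV (diff m) t :> diff (Suc m) t" if "m < 3" "0 \<le> t" "t \<le> 1" for m t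
  proof -
    have "f differentiable at (x + t *\<^sub>R h)" "Dfr f differentiable at (x + t *\<^sub>R h)"
      "Dfr (Dfr f) differentiable at (x + t *\<^sub>R h)"
      using f seg that(2,3) unfolding thrice_differentiable_on_def by blast+
    moreover have "m = 0 \<or> m = 1 \<or> m = 2" using that(1) by linarith
    ultimately show ?thesis
      using has_real_derivative_along_line[of f x t h "\<lambda>y. y"]
        has_real_derivative_along_line[OF _ bl1, of "Dfr f" x t]
        has_real_derivative_along_line[OF _ bl2, of "Dfr (Dfr f)" x t]
      unfolding diff_def by (auto simp: bounded_linear_ident)
  qed
  then obtain t where t: "0 < t" "t < 1"
    and "f (x + 1 *\<^sub>R h) = (\<Sum>m<3. diff m 0 / fact m * 1 ^ m) + diff 3 t / fact 3 * 1 ^ 3"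
    using Maclaurin[of 1 3 diff "\<lambda>t. f (x + t *\<^sub>R h)"] unfolding diff_def by auto
  then have remainder: "f (x + h) - f x - Dfr f x h - Dfr (Dfr f) x h h / 2 =
      Dfr (Dfr (Dfr f)) (x + t *\<^sub>R h) h h h / 6"
    by (simp add: diff_def eval_nat_numeral fact_numeral)
  have "\<bar>Dfr (Dfr (Dfr f)) (x + t *\<^sub>R h) h h h\<bar> \<le> K * norm h ^ 3"
    using norm_blinfun_apply3_le[of "Dfr (Dfr (Dfr f)) (x + t *\<^sub>R h)" h] bnd[of t] t
    by (meson less_imp_le mult_right_mono norm_ge_zero order_trans zero_le_power)
  then show ?thesis unfolding remainder by simp
qed

section \<open>Gaussian integrals\<close>

lemma nn_integral_lborel_affine:
  fixes f :: "'a::euclidean_space \<Rightarrow> ennreal" and t :: 'a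
  assumes [measurable]: "f \<in> borel_measurable borel" and c: "c \<noteq> 0"
  shows "(\<integral>\<^sup>+x. f x \<partial>lborel) = ennreal (\<bar>c\<bar> ^ DIM('a)) * (\<integral>\<^sup>+u. f (t + c *\<^sub>R u) \<partial>lborel)"
  by (subst lborel_affine[OF c, of t])
     (simp add: nn_integral_density nn_integral_distr nn_integral_cmult)

lemma power_div_fact_le_exp:
  fixes x :: real assumes "0 \<le> x" shows "x ^ n / fact n \<le> exp x"
proof -
  have "(\<Sum>m\<in>{n}. x ^ m /\<^sub>R fact m) \<le> (\<Sum>m. x ^ m /\<^sub>R fact m)"
    using assms by (intro sum_le_suminf summable_exp_generic) auto
  then show ?thesis by (simp add: exp_def divide_inverse mult.commute)
qed

lemma inverse_power_le_suminf_balls: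
  fixes u :: "'a::real_normed_vector"
  shows "ennreal (1 / (1 + norm u) ^ k) \<le>
    (\<Sum>j. ennreal (1 / (1 + real j) ^ k) * indicator (ball 0 (real j + 1)) u)"
proof -
  define j where "j = nat \<lfloor>norm u\<rfloor>"
  have "real j = of_int \<lfloor>norm u\<rfloor>" unfolding j_def by simp
  then have j: "real j \<le> norm u \<and> norm u < real j + 1" by linarith
  then have "ennreal (1 / (1 + norm u) ^ k) \<le> ennreal (1 / (1 + real j) ^ k) * indicator (ball 0 (real j + 1)) u"
    by (simp add: ennreal_leI divide_left_mono power_mono)
  also have "\<dots> \<le> (\<Sum>i. ennreal (1 / (1 + real i) ^ k) * indicator (ball 0 (real i + 1)) u)"
    by (rule sum_le_suminf[of _ "{j}", simplified]) (auto intro: summableI)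
  finally show ?thesis .
qed

lemma nn_integral_inverse_power_finite:
  "(\<integral>\<^sup>+u. ennreal (1 / (1 + norm u) ^ (DIM('a) + 2)) \<partial>(lborel::'a::euclidean_space measure)) < \<infinity>"
proof -
  define D where "D = DIM('a)"
  define V where "V = unit_ball_vol (real D)"
  have ball_term: "ennreal (1 / (1 + real j) ^ (D + 2)) * emeasure lborel (ball (0::'a) (real j + 1))
      = ennreal (V / (1 + real j) ^ 2)" for j
  proof -
    have "emeasure lborel (ball (0::'a) (real j + 1)) = ennreal (V * (real j + 1) ^ D)"
      unfolding V_def D_def by (rule emeasure_ball) simp
    moreover have "1 / (1 + real j) ^ (D + 2) * (V * (real j + 1) ^ D) = V / (1 + real j) ^ 2"
      by (simp add: power_add add.commute power2_eq_square)
    ultimately show ?thesis unfolding V_def by (simp add: ennreal_mult[symmetric])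
  qed
  have "summable (\<lambda>j. inverse (real (Suc j) ^ 2))"
    using inverse_power_summable[of 2] by (subst summable_Suc_iff) auto
  then have summ: "summable (\<lambda>j. V / (1 + real j) ^ 2)"
    using summable_mult[of _ V] by (simp add: divide_inverse add.commute)
  have "(\<integral>\<^sup>+u. ennreal (1 / (1 + norm u) ^ (D + 2)) \<partial>(lborel::'a measure))
      \<le> (\<integral>\<^sup>+u. (\<Sum>j. ennreal (1 / (1 + real j) ^ (D + 2)) * indicator (ball (0::'a) (real j + 1)) u) \<partial>lborel)"
    by (rule nn_integral_mono) (rule inverse_power_le_suminf_balls)
  also have "\<dots> = (\<Sum>j. ennreal (1 / (1 + real j) ^ (D + 2)) * emeasure lborel (ball (0::'a) (real j + 1)))"
    by (subst nn_integral_suminf)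
      (auto simp: nn_integral_cmult_indicator intro!: borel_measurable_times_ennreal borel_measurable_indicator)
  also have "\<dots> = ennreal (\<Sum>j. V / (1 + real j) ^ 2)"
    unfolding ball_term using summ by (intro suminf_ennreal2) (auto simp: V_def)
  finally show ?thesis unfolding D_def by (simp add: order_le_less_trans)
qed

lemma power_mult_exp_neg_square_le:
  fixes c :: real assumes c: "0 < c"
  obtains C where "C \<ge> 0" "\<And>t. 0 \<le> t \<Longrightarrow> t ^ k * exp (- c * t ^ 2) \<le> C * (1 / (1 + t) ^ m)"
proof
  define M where "M = k + m"
  define C where "C = 2 ^ M * (2 + fact M / c ^ M)"
  show "C \<ge> 0" using c unfolding C_def by simp
  fix t :: real assume t: "0 \<le> t"
  define E where "E = exp (c * t ^ 2)"
  have E: "E \<ge> 1" using c t unfolding E_def by simp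
  have "(c * t ^ 2) ^ M / fact M \<le> E"
    using c t unfolding E_def by (intro power_div_fact_le_exp) auto
  then have t2M: "(t ^ 2) ^ M \<le> fact M / c ^ M * E"
    using c by (simp add: power_mult_distrib field_simps)
  have tM: "t ^ M \<le> 1 + (t ^ 2) ^ M"
  proof (cases "t \<le> 1")
    case True then show ?thesis using t by (simp add: power_le_one add_increasing2)
  next
    case False then show ?thesis using t by (simp add: power_mono power2_eq_square add_increasing)
  qed
  have "t ^ k * (1 + t) ^ m \<le> (1 + t) ^ M"
    using t unfolding M_def power_add by (intro mult_right_mono power_mono) auto
  also have "\<dots> \<le> (2 * max 1 t) ^ M" using t by (intro power_mono) auto
  also have "\<dots> \<le> 2 ^ M * (1 + t ^ M)"
    using t by (cases "t \<le> 1") (auto simp: max_def power_mult_distrib)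
  also have "\<dots> \<le> C * E"
  proof -
    have "1 + t ^ M \<le> 2 + fact M / c ^ M * E" using tM t2M by linarith
    also have "\<dots> \<le> (2 + fact M / c ^ M) * E" using c E by (simp add: algebra_simps)
    finally show ?thesis unfolding C_def by (simp add: mult.assoc)
  qed
  finally have bound: "t ^ k * (1 + t) ^ m / E \<le> C" using E by (simp add: divide_le_eq)
  have split: "t ^ k * exp (- c * t ^ 2) = t ^ k * (1 + t) ^ m / E * (1 / (1 + t) ^ m)"
    using t unfolding E_def by (simp add: exp_minus field_simps)
  show "t ^ k * exp (- c * t ^ 2) \<le> C * (1 / (1 + t) ^ m)"
    unfolding split by (rule mult_right_mono[OF bound]) (use t in simp)
qed

lemma nn_integral_gaussian_moment_finite:
  fixes c :: real assumes c: "0 < c"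
  shows "(\<integral>\<^sup>+u. ennreal (norm u ^ k * exp (- c * norm u ^ 2)) \<partial>(lborel::'a::euclidean_space measure)) < \<infinity>"
proof -
  obtain C where C: "C \<ge> 0"
    "\<And>t. 0 \<le> t \<Longrightarrow> t ^ k * exp (- c * t ^ 2) \<le> C * (1 / (1 + t) ^ (DIM('a) + 2))"
    using power_mult_exp_neg_square_le[OF c] by blast
  have "(\<integral>\<^sup>+u. ennreal (norm u ^ k * exp (- c * norm u ^ 2)) \<partial>(lborel::'a measure))
     \<le> (\<integral>\<^sup>+u. ennreal C * ennreal (1 / (1 + norm (u::'a)) ^ (DIM('a) + 2)) \<partial>lborel)"
    using C by (intro nn_integral_mono) (simp add: ennreal_mult[symmetric] ennreal_leI)
  also have "\<dots> = ennreal C * (\<integral>\<^sup>+u. ennreal (1 / (1 + norm (u::'a)) ^ (DIM('a) + 2)) \<partial>lborel)"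
    by (rule nn_integral_cmult) auto
  also have "\<dots> < \<infinity>"
    using nn_integral_inverse_power_finite[where 'a='a] by (simp add: ennreal_mult_less_top)
  finally show ?thesis .
qed

lemma nn_integral_gaussian_pos:
  fixes a :: real assumes "a > 0"
  shows "0 < enn2real (\<integral>\<^sup>+u. ennreal (exp (- a * norm u ^ 2)) \<partial>(lborel::'a::euclidean_space measure))"
proof -
  let ?I = "(\<integral>\<^sup>+u. ennreal (exp (- a * norm u ^ 2)) \<partial>(lborel::'a measure))"
  have "?I < \<infinity>" using nn_integral_gaussian_moment_finite[OF assms, of 0] by simp
  moreover have "?I \<noteq> 0"
  proof
    assume "?I = 0"
    then have "AE u in (lborel::'a measure). False" by (subst (asm) nn_integral_0_iff_AE) auto
    then show False by (simp add: ae_filter_eq_bot_iff trivial_limit_def[symmetric])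
  qed
  ultimately show ?thesis
    by (simp add: enn2real_positive_iff less_top[symmetric] zero_less_iff_neq_zero)
qed

lemma nn_integral_gaussian_moment_rescale:
  fixes z :: "'a::euclidean_space" and a :: real and n :: nat
  assumes a: "a > 0" and n: "n \<ge> 1"
  defines "s \<equiv> 1 / sqrt (real n)"
  shows "(\<integral>\<^sup>+x. ennreal (norm (x - z) ^ k * exp (- (real n * a) * norm (x - z) ^ 2)) \<partial>lborel)
    = ennreal (s ^ DIM('a) * s ^ k *
        enn2real (\<integral>\<^sup>+u. ennreal (norm u ^ k * exp (- a * norm u ^ 2)) \<partial>(lborel::'a measure)))"
proof -
  have s: "s > 0" "real n * s ^ 2 = 1" using n unfolding s_def by (auto simp: power_divide)
  let ?G = "\<lambda>u::'a. ennreal (norm u ^ k * exp (- a * norm u ^ 2))"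
  have rescale: "ennreal (norm (z + s *\<^sub>R u - z) ^ k * exp (- (real n * a) * norm (z + s *\<^sub>R u - z) ^ 2))
      = ennreal (s ^ k) * ?G u" for u
  proof -
    have "real n * a * (s * norm u) ^ 2 = a * norm u ^ 2"
      using s(2) by (simp add: power_mult_distrib algebra_simps)
    then show ?thesis using s by (simp add: ennreal_mult[symmetric] power_mult_distrib mult.assoc)
  qed
  have "(\<integral>\<^sup>+x. ennreal (norm (x - z) ^ k * exp (- (real n * a) * norm (x - z) ^ 2)) \<partial>lborel)
      = ennreal (\<bar>s\<bar> ^ DIM('a)) * (\<integral>\<^sup>+u. ennreal (norm (z + s *\<^sub>R u - z) ^ k *
          exp (- (real n * a) * norm (z + s *\<^sub>R u - z) ^ 2)) \<partial>lborel)"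
    using s by (intro nn_integral_lborel_affine) auto
  also have "\<dots> = ennreal (\<bar>s\<bar> ^ DIM('a)) * (\<integral>\<^sup>+u. ennreal (s ^ k) * ?G u \<partial>lborel)"
    by (simp only: rescale)
  also have "\<dots> = ennreal (\<bar>s\<bar> ^ DIM('a)) * (ennreal (s ^ k) * ennreal (enn2real (integral\<^sup>N lborel ?G)))"
    using nn_integral_gaussian_moment_finite[OF a, of k, where 'a='a]
    by (simp add: nn_integral_cmult ennreal_enn2real less_top)
  finally show ?thesis using s by (simp add: ennreal_mult[symmetric] mult.assoc)
qed

lemma abs_exp_minus_one_le: "\<bar>exp a - 1\<bar> \<le> \<bar>a\<bar> * exp \<bar>a\<bar>" for a :: real
proof (cases "a \<ge> 0")
  case True
  have "1 - a \<le> exp (- a)" using exp_ge_add_one_self[of "-a"] by simp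
  then have "(1 - a) * exp a \<le> 1" by (simp add: exp_minus field_simps)
  then show ?thesis using True by (simp add: algebra_simps)
next
  case False
  have "1 + a \<le> exp a" "exp a \<le> 1" using False by auto
  then have "\<bar>exp a - 1\<bar> \<le> \<bar>a\<bar>" using False by linarith
  also have "\<dots> \<le> \<bar>a\<bar> * exp \<bar>a\<bar>" by (simp add: mult_le_cancel_left1)
  finally show ?thesis .
qed

lemma abs_root_minus_one_power_le:
  fixes r :: real and p :: nat assumes r: "0 \<le> r" and p: "p \<ge> 1"
  shows "\<bar>r powr (1 / real p) - 1\<bar> ^ p \<le> r + 1"
proof (cases "r \<le> 1")
  case True
  then have "\<bar>r powr (1 / real p) - 1\<bar> \<le> 1" using r p by (simp add: powr_le1)
  then have "\<bar>r powr (1 / real p) - 1\<bar> ^ p \<le> 1" by (simp add: power_le_one)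
  then show ?thesis using r by linarith
next
  case False
  then have "1 \<le> r powr (1 / real p)" using p by (simp add: ge_one_powr_ge_zero)
  then have "\<bar>r powr (1 / real p) - 1\<bar> ^ p \<le> (r powr (1 / real p)) ^ p"
    by (intro power_mono) auto
  also have "\<dots> = r"
    using False p by (simp add: powr_realpow[symmetric] powr_powr)
  finally show ?thesis by linarith
qed

lemma abs_exp_root_minus_one_power_le:
  fixes R :: real and p :: nat assumes p: "p \<ge> 1"
  shows "\<bar>exp (- R) powr (1 / real p) - 1\<bar> ^ p \<le> \<bar>R\<bar> ^ p * exp \<bar>R\<bar>"
proof -
  have "\<bar>exp (- R / real p) - 1\<bar> \<le> \<bar>R / real p\<bar> * exp \<bar>R / real p\<bar>"
    using abs_exp_minus_one_le[of "- R / real p"] by simp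
  also have "\<dots> \<le> \<bar>R\<bar> * exp (\<bar>R\<bar> / real p)"
    using p by (intro mult_mono) (auto simp: abs_divide divide_le_eq mult_le_cancel_left1)
  finally have "\<bar>exp (- R / real p) - 1\<bar> ^ p \<le> (\<bar>R\<bar> * exp (\<bar>R\<bar> / real p)) ^ p"
    by (intro power_mono) auto
  also have "\<dots> = \<bar>R\<bar> ^ p * exp \<bar>R\<bar>"
    using p by (simp add: power_mult_distrib exp_of_nat_mult[symmetric])
  finally show ?thesis by (simp add: powr_def)
qed

lemma exp_mult_power_le_powr:
  fixes a :: real and n :: nat
  assumes a: "a > 0" and n: "n \<ge> 1"
  shows "exp (- a * real n) * real n ^ D \<le> fact (D + p) / a ^ (D + p) * real n powr (- real p / 2)"
proof -
  have nn: "real n \<ge> 1" using n by simp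
  have "(a * real n) ^ (D + p) / fact (D + p) \<le> exp (a * real n)"
    using a n by (intro power_div_fact_le_exp) auto
  then have "exp (- a * real n) \<le> fact (D + p) / (a * real n) ^ (D + p)"
    using a nn by (simp add: exp_minus field_simps)
  then have "exp (- a * real n) * real n ^ D \<le> fact (D + p) / (a * real n) ^ (D + p) * real n ^ D"
    by (intro mult_right_mono) auto
  also have "\<dots> = fact (D + p) / a ^ (D + p) * (1 / real n ^ p)"
    using a nn by (simp add: power_mult_distrib power_add field_simps)
  also have "\<dots> \<le> fact (D + p) / a ^ (D + p) * real n powr (- real p / 2)"
  proof -
    have "1 / real n ^ p = real n powr (- real p)"
      using nn by (simp add: powr_minus powr_realpow divide_inverse)
    also have "\<dots> \<le> real n powr (- real p / 2)" using nn by (intro powr_mono) auto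
    finally show ?thesis using a by (intro mult_left_mono) auto
  qed
  finally show ?thesis .
qed

lemma inverse_sqrt_power_eq_powr:
  assumes "n \<ge> 1" shows "(1 / sqrt (real n)) ^ p = real n powr (- real p / 2)"
proof -
  have "1 / sqrt (real n) = real n powr (- (1/2))"
    using assms by (simp add: powr_minus_divide powr_half_sqrt)
  then show ?thesis using assms by (simp add: powr_power)
qed

lemma laplace_error_terms_le_powr:
  fixes n D p :: nat
  assumes n: "n \<ge> 1" and a1: "a1 > 0" and a2: "a2 > 0"
    and M1: "M1 \<ge> 0" and M0: "M0 \<ge> 0" and Q: "Q \<ge> 0" and K: "K \<ge> 0"
  shows "K ^ p * (1 / sqrt (real n)) ^ p * M1 + exp (- real n * a1) * M0
      + exp (- real n * a2) * Q / (1 / sqrt (real n)) ^ D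
    \<le> (K ^ p * M1 + fact (D + p) / a1 ^ (D + p) * M0 + fact (D + p) / a2 ^ (D + p) * Q)
      * real n powr (- real p / 2)"
proof -
  have nn: "real n \<ge> 1" using n by simp
  have "exp (- real n * a1) \<le> exp (- a1 * real n) * real n ^ D"
    using nn by (simp add: mult.commute)
  also have "\<dots> \<le> fact (D + p) / a1 ^ (D + p) * real n powr (- real p / 2)"
    by (rule exp_mult_power_le_powr[OF a1 n])
  finally have "exp (- real n * a1) * M0 \<le> fact (D + p) / a1 ^ (D + p) * real n powr (- real p / 2) * M0"
    using M0 by (rule mult_right_mono)
  then have t1: "exp (- real n * a1) * M0 \<le> fact (D + p) / a1 ^ (D + p) * M0 * real n powr (- real p / 2)"
    by (simp only: mult_ac)
  have "exp (- real n * a2) / (1 / sqrt (real n)) ^ D = exp (- a2 * real n) * sqrt (real n) ^ D"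
    by (simp add: power_divide mult.commute)
  also have "\<dots> \<le> exp (- a2 * real n) * real n ^ D"
    using nn by (intro mult_left_mono power_mono) (auto simp: real_sqrt_le_iff' power2_eq_square)
  also have "\<dots> \<le> fact (D + p) / a2 ^ (D + p) * real n powr (- real p / 2)"
    by (rule exp_mult_power_le_powr[OF a2 n])
  finally have "exp (- real n * a2) / (1 / sqrt (real n)) ^ D * Q
      \<le> fact (D + p) / a2 ^ (D + p) * real n powr (- real p / 2) * Q"
    using Q by (rule mult_right_mono)
  then have t2: "exp (- real n * a2) * Q / (1 / sqrt (real n)) ^ D
      \<le> fact (D + p) / a2 ^ (D + p) * Q * real n powr (- real p / 2)"
    by (simp add: mult_ac)
  show ?thesis
    using t1 t2 unfolding inverse_sqrt_power_eq_powr[OF n] distrib_right by (simp only: mult_ac)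
qed

lemma gaussian_ratio_deviation_near_le:
  fixes n K lam a i t :: real and p :: nat
  assumes n: "n \<ge> 0" and p: "p \<ge> 1" and K: "K \<ge> 0" and t: "t \<ge> 0"
    and Kt: "K * t \<le> lam / 4" and a: "lam * t ^ 2 \<le> a" and i: "\<bar>i - a / 2\<bar> \<le> K * t ^ 3"
  shows "exp (- (n / 2) * a) * \<bar>(exp (- n * i) / exp (- (n / 2) * a)) powr (1 / real p) - 1\<bar> ^ p
    \<le> (n * K) ^ p * t ^ (3 * p) * exp (- (n * (lam / 4)) * t ^ 2)"
proof -
  define R where "R = n * (i - a / 2)"
  define X where "X = n * K * t ^ 3"
  define Y where "Y = n * (lam / 4) * t ^ 2"
  have ratio: "exp (- n * i) / exp (- (n / 2) * a) = exp (- R)"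
    unfolding R_def by (simp add: exp_diff[symmetric] algebra_simps)
  have RX: "\<bar>R\<bar> \<le> X" unfolding R_def X_def using mult_left_mono[OF i n] n by (simp add: abs_mult mult.assoc)
  have "K * t ^ 3 \<le> (lam / 4) * t ^ 2"
    using mult_right_mono[OF Kt, of "t ^ 2"] t by (simp add: power3_eq_cube power2_eq_square mult_ac)
  then have XY: "X \<le> Y" unfolding X_def Y_def using n by (simp add: mult.assoc mult_left_mono)
  have "exp (- (n / 2) * a) \<le> exp (- 2 * Y)"
    unfolding Y_def using mult_left_mono[OF a n] by (simp add: mult_ac)
  moreover have "\<bar>exp (- R) powr (1 / real p) - 1\<bar> ^ p \<le> X ^ p * exp X"
    using abs_exp_root_minus_one_power_le[OF p, of R] RX
    by (meson abs_ge_zero exp_le_cancel_iff mult_mono order_trans power_mono exp_ge_zero zero_le_power)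
  ultimately have "exp (- (n / 2) * a) * \<bar>exp (- R) powr (1 / real p) - 1\<bar> ^ p \<le> exp (- 2 * Y) * (X ^ p * exp X)"
    by (intro mult_mono) auto
  also have "\<dots> = X ^ p * exp (X - 2 * Y)" by (simp add: exp_diff exp_minus field_simps)
  also have "\<dots> \<le> X ^ p * exp (- Y)"
    using XY RX by (intro mult_left_mono) auto
  also have "\<dots> = (n * K) ^ p * t ^ (3 * p) * exp (- (n * (lam / 4)) * t ^ 2)"
    unfolding X_def Y_def by (simp add: power_mult_distrib power_mult)
  finally show ?thesis unfolding ratio .
qed

lemma weighted_root_deviation_le:
  fixes a b :: real assumes "a \<ge> 0" "b > 0" "p \<ge> 1"
  shows "b * \<bar>(a / b) powr (1 / real p) - 1\<bar> ^ p \<le> a + b"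
proof -
  have "b * \<bar>(a / b) powr (1 / real p) - 1\<bar> ^ p \<le> b * (a / b + 1)"
    using assms by (intro mult_left_mono abs_root_minus_one_power_le) auto
  also have "\<dots> = a + b" using assms by (simp add: field_simps)
  finally show ?thesis .
qed

lemma exp_neg_le_tail_split:
  fixes n I q \<delta> \<epsilon> :: real
  assumes "n \<ge> 0" "\<delta> \<le> I" "exp (- n * I) \<le> q" "0 < \<epsilon>" "\<epsilon> < 1"
  shows "exp (- n * I) \<le> exp (- n * \<epsilon> * \<delta>) * q powr (1 - \<epsilon>)"
proof -
  have "exp (- n * I) = exp (- n * \<epsilon> * I) * exp (- n * I) powr (1 - \<epsilon>)"
    by (simp add: powr_def exp_add[symmetric] algebra_simps)
  also have "\<dots> \<le> exp (- n * \<epsilon> * \<delta>) * q powr (1 - \<epsilon>)"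
    using assms by (intro mult_mono powr_mono2) (auto simp: mult_left_mono)
  finally show ?thesis .
qed

lemma gaussian_tail_split:
  fixes n lam a t \<rho> :: real
  assumes "n \<ge> 0" "lam > 0" "0 \<le> \<rho>" "\<rho> \<le> t" "lam * t ^ 2 \<le> a"
  shows "exp (- (n / 2) * a) \<le> exp (- n * (lam / 4) * \<rho> ^ 2) * exp (- (n * (lam / 4)) * t ^ 2)"
proof -
  have "\<rho> ^ 2 \<le> t ^ 2" using assms by (intro power_mono) auto
  then have "n * (lam / 4) * \<rho> ^ 2 \<le> n * (lam / 4) * t ^ 2"
    using assms by (intro mult_left_mono) auto
  moreover have "n * (lam / 2) * t ^ 2 \<le> (n / 2) * a"
    using mult_left_mono[OF assms(5), of "n / 2"] assms(1) by (simp add: algebra_simps)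
  ultimately have "n * (lam / 4) * \<rho> ^ 2 + n * (lam / 4) * t ^ 2 \<le> (n / 2) * a" by linarith
  then show ?thesis by (simp add: exp_add[symmetric] field_simps)
qed

section \<open>The deviation integral for fixed n\<close>

lemma integrable_normalised_density_le:
  fixes w g :: "'a \<Rightarrow> real"
  assumes [measurable]: "w \<in> borel_measurable M" "g \<in> borel_measurable M"
    and w: "\<And>x. w x \<ge> 0" and g: "\<And>x. g x \<ge> 0" and Z: "0 < Z0" "Z0 \<le> Z" and B: "B \<ge> 0"
    and bound: "(\<integral>\<^sup>+x. ennreal (w x * g x) \<partial>M) \<le> ennreal B"
  shows "integrable (density M (\<lambda>x. ennreal (w x / Z))) g \<and>
    (\<integral>x. g x \<partial>density M (\<lambda>x. ennreal (w x / Z))) \<le> B / Z0"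
proof -
  have wZ: "w x / Z \<ge> 0" for x using w Z by simp
  have wZg: "w x / Z * g x \<ge> 0" for x using wZ g by (rule mult_nonneg_nonneg)
  have nn: "(\<integral>\<^sup>+x. ennreal (w x / Z * g x) \<partial>M) = (\<integral>\<^sup>+x. ennreal (w x * g x) \<partial>M) / ennreal Z"
    using w g Z
    by (subst nn_integral_divide[symmetric]) (auto intro!: nn_integral_cong simp: divide_ennreal)
  also have "\<dots> \<le> ennreal (B / Z)"
    using bound Z B by (simp add: divide_ennreal[symmetric] divide_right_mono_ennreal)
  finally have nn_le: "(\<integral>\<^sup>+x. ennreal (w x / Z * g x) \<partial>M) \<le> ennreal (B / Z)" .
  have int: "integrable M (\<lambda>x. w x / Z * g x)"
    using nn_le wZg by (intro integrableI_nonneg) (auto intro: order_le_less_trans)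
  have "(\<integral>x. g x \<partial>density M (\<lambda>x. ennreal (w x / Z))) = (\<integral>x. w x / Z * g x \<partial>M)"
    using wZ by (subst integral_density) auto
  also have "\<dots> = enn2real (\<integral>\<^sup>+x. ennreal (w x / Z * g x) \<partial>M)"
    using wZg by (intro integral_eq_nn_integral) auto
  also have "\<dots> \<le> B / Z" using enn2real_mono[OF nn_le] B Z by simp
  also have "\<dots> \<le> B / Z0" using Z B by (intro divide_left_mono) auto
  finally show ?thesis using int wZ by (simp add: integrable_density)
qed

locale laplace_step =
  fixes S :: "'a::euclidean_space set" and I :: "'a \<Rightarrow> real" and x0 :: 'a
    and A :: "'a \<Rightarrow>\<^sub>L 'a \<Rightarrow>\<^sub>L real" and q :: "'a \<Rightarrow> real"
    and n p :: nat and lam Lam \<rho> K \<delta> \<epsilon> :: real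
  assumes n: "n \<ge> 1" and p: "p \<ge> 1" and open_S: "open S" and cont_I: "continuous_on S I"
    and lam: "lam > 0" and A_lower: "\<And>v. lam * norm v ^ 2 \<le> A v v"
    and A_upper: "\<And>v. A v v \<le> Lam * norm v ^ 2"
    and \<rho>: "\<rho> > 0" and K: "K \<ge> 0" and K\<rho>: "K * \<rho> \<le> lam / 4"
    and near: "\<And>h. norm h < \<rho> \<Longrightarrow> x0 + h \<in> S \<and> \<bar>I (x0 + h) - A h h / 2\<bar> \<le> K * norm h ^ 3"
    and tail: "\<And>y. y \<in> S \<Longrightarrow> \<rho> \<le> norm (y - x0) \<Longrightarrow> \<delta> \<le> I y" and \<delta>: "\<delta> > 0"
    and \<epsilon>: "0 < \<epsilon>" "\<epsilon> < 1"
    and q_bound: "\<And>y. y \<in> S \<Longrightarrow> exp (- real n * I y) \<le> q y"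
    and q_int: "set_integrable lborel S (\<lambda>y. q y powr (1 - \<epsilon>))"
begin

definition target :: "'a \<Rightarrow> real" where
  "target x = (if x \<in> S then exp (- real n * I x) else 0)"

definition gauss_weight :: "'a \<Rightarrow> real" where
  "gauss_weight x = exp (- (real n / 2) * A (x - x0) (x - x0))"

definition deviation :: "'a \<Rightarrow> real" where
  "deviation x = \<bar>(target x / gauss_weight x) powr (1 / real p) - 1\<bar> ^ p"

(* The three terms dominate the integrand on the ball norm (x - x0) < rho, the Gaussian weight
   off the ball, and the target off the ball. *)
definition majorant :: "'a \<Rightarrow> real" where
  "majorant x =
     (real n * K) ^ p * (norm (x - x0) ^ (3 * p) * exp (- (real n * (lam / 4)) * norm (x - x0) ^ 2))
   + exp (- real n * (lam / 4) * \<rho> ^ 2) * exp (- (real n * (lam / 4)) * norm (x - x0) ^ 2)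
   + exp (- real n * \<epsilon> * \<delta>) * (indicator S x * q x powr (1 - \<epsilon>))"

(* Independent of n, x0, A and I: this is what makes the bound uniform along a sequence. *)
definition deviation_const :: real where
  "deviation_const =
    (K ^ p * enn2real (\<integral>\<^sup>+u. ennreal (norm u ^ (3 * p) * exp (- (lam / 4) * norm u ^ 2)) \<partial>(lborel::'a measure))
     + fact (DIM('a) + p) / (lam / 4 * \<rho> ^ 2) ^ (DIM('a) + p) *
         enn2real (\<integral>\<^sup>+u. ennreal (exp (- (lam / 4) * norm u ^ 2)) \<partial>(lborel::'a measure))
     + fact (DIM('a) + p) / (\<epsilon> * \<delta>) ^ (DIM('a) + p) * (LINT y:S|lborel. q y powr (1 - \<epsilon>)))
    / enn2real (\<integral>\<^sup>+u. ennreal (exp (- (Lam / 2) * norm u ^ 2)) \<partial>(lborel::'a measure))"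

lemma Lam_pos: "Lam > 0"
proof -
  obtain b :: 'a where "b \<in> Basis" using nonempty_Basis by blast
  then show ?thesis
    using A_lower[of b] A_upper[of b] lam by (simp add: norm_Basis)
qed

lemma gauss_weight_bounds:
  "exp (- (real n * (Lam / 2)) * norm (x - x0) ^ 2) \<le> gauss_weight x"
  "gauss_weight x \<le> exp (- (real n * (lam / 2)) * norm (x - x0) ^ 2)"
  unfolding gauss_weight_def
  using mult_left_mono[OF A_lower[of "x - x0"], of "real n"] mult_left_mono[OF A_upper[of "x - x0"], of "real n"]
  by (simp_all add: mult_ac)

lemma borel_measurable_step_functions [measurable]:
  "gauss_weight \<in> borel_measurable borel" "target \<in> borel_measurable borel"
  "deviation \<in> borel_measurable borel"
proof -
  show gw: "gauss_weight \<in> borel_measurable borel"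
    unfolding gauss_weight_def
    by (intro borel_measurable_continuous_onI continuous_intros blinfun.continuous_on)
  have target_eq: "target = (\<lambda>x. indicator S x *\<^sub>R exp (- real n * I x))"
    unfolding target_def by (auto simp: fun_eq_iff indicator_def)
  show tg: "target \<in> borel_measurable borel"
    unfolding target_eq using open_S cont_I
    by (intro borel_measurable_continuous_on_indicator continuous_intros) auto
  show "deviation \<in> borel_measurable borel"
    unfolding deviation_def using gw tg by measurable
qed

lemma deviation_le_majorant: "gauss_weight x * deviation x \<le> majorant x"
proof -
  let ?T1 = "(real n * K) ^ p * (norm (x - x0) ^ (3 * p) * exp (- (real n * (lam / 4)) * norm (x - x0) ^ 2))"
  let ?T2 = "exp (- real n * (lam / 4) * \<rho> ^ 2) * exp (- (real n * (lam / 4)) * norm (x - x0) ^ 2)"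
  let ?T3 = "exp (- real n * \<epsilon> * \<delta>) * (indicator S x * q x powr (1 - \<epsilon>))"
  have T_nonneg: "?T1 \<ge> 0" "?T2 \<ge> 0" "?T3 \<ge> 0" using K by auto
  show ?thesis
  proof (cases "norm (x - x0) < \<rho>")
    case True
    with near[of "x - x0"] have "x \<in> S" "\<bar>I x - A (x - x0) (x - x0) / 2\<bar> \<le> K * norm (x - x0) ^ 3"
      by auto
    then have "gauss_weight x * deviation x \<le> ?T1"
      using gaussian_ratio_deviation_near_le[OF _ p K norm_ge_zero _ A_lower, of "real n" "x - x0" "I x"]
        True K K\<rho> mult_left_mono[OF less_imp_le[OF True] K]
      unfolding gauss_weight_def deviation_def target_def by (simp add: mult.assoc)
    then show ?thesis unfolding majorant_def using T_nonneg by linarith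
  next
    case False
    have "gauss_weight x * deviation x \<le> target x + gauss_weight x"
      unfolding deviation_def gauss_weight_def target_def
      by (intro weighted_root_deviation_le p) auto
    moreover have "target x \<le> ?T3"
    proof (cases "x \<in> S")
      case True
      then show ?thesis
        using exp_neg_le_tail_split[of "real n" \<delta> "I x" "q x" \<epsilon>] tail[OF True] q_bound[OF True] False \<epsilon>
        by (simp add: target_def)
    qed (simp add: target_def)
    moreover have "gauss_weight x \<le> ?T2"
      using gaussian_tail_split[OF _ lam _ _ A_lower, of "real n" \<rho> "x - x0"] False \<rho>
      unfolding gauss_weight_def by simp
    ultimately show ?thesis unfolding majorant_def using T_nonneg by linarith
  qed
qed

lemma normaliser_ge:
  "(1 / sqrt (real n)) ^ DIM('a) *
     enn2real (\<integral>\<^sup>+u. ennreal (exp (- (Lam / 2) * norm u ^ 2)) \<partial>(lborel::'a measure))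
   \<le> (\<integral>x. gauss_weight x \<partial>lborel)"
proof -
  have gw_pos: "gauss_weight x > 0" for x unfolding gauss_weight_def by simp
  have "(\<integral>\<^sup>+x. ennreal (gauss_weight x) \<partial>lborel)
      \<le> (\<integral>\<^sup>+x. ennreal (norm (x - x0) ^ 0 * exp (- (real n * (lam / 2)) * norm (x - x0) ^ 2)) \<partial>lborel)"
    using gauss_weight_bounds(2) by (intro nn_integral_mono) (simp add: ennreal_leI)
  also have "\<dots> < \<infinity>"
    using nn_integral_gaussian_moment_rescale[where a="lam / 2" and n=n and k=0 and z=x0] lam n by simp
  finally have fin: "(\<integral>\<^sup>+x. ennreal (gauss_weight x) \<partial>lborel) < \<infinity>" .
  have "ennreal ((1 / sqrt (real n)) ^ DIM('a) *
      enn2real (\<integral>\<^sup>+u. ennreal (exp (- (Lam / 2) * norm u ^ 2)) \<partial>(lborel::'a measure)))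
    = (\<integral>\<^sup>+x. ennreal (norm (x - x0) ^ 0 * exp (- (real n * (Lam / 2)) * norm (x - x0) ^ 2)) \<partial>lborel)"
    using nn_integral_gaussian_moment_rescale[where a="Lam / 2" and n=n and k=0 and z=x0] Lam_pos n by simp
  also have "\<dots> \<le> (\<integral>\<^sup>+x. ennreal (gauss_weight x) \<partial>lborel)"
    using gauss_weight_bounds(1) by (intro nn_integral_mono) (simp add: ennreal_leI)
  finally have "ennreal ((1 / sqrt (real n)) ^ DIM('a) *
      enn2real (\<integral>\<^sup>+u. ennreal (exp (- (Lam / 2) * norm u ^ 2)) \<partial>(lborel::'a measure)))
    \<le> (\<integral>\<^sup>+x. ennreal (gauss_weight x) \<partial>lborel)" .
  then have "enn2real (ennreal ((1 / sqrt (real n)) ^ DIM('a) *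
      enn2real (\<integral>\<^sup>+u. ennreal (exp (- (Lam / 2) * norm u ^ 2)) \<partial>(lborel::'a measure))))
    \<le> enn2real (\<integral>\<^sup>+x. ennreal (gauss_weight x) \<partial>lborel)"
    using fin by (intro enn2real_mono) auto
  then show ?thesis
    using gw_pos by (subst integral_eq_nn_integral) (auto intro: less_imp_le)
qed

lemma nn_integral_majorant:
  defines "s \<equiv> 1 / sqrt (real n)"
    and "M1 \<equiv> enn2real (\<integral>\<^sup>+u. ennreal (norm u ^ (3 * p) * exp (- (lam / 4) * norm u ^ 2)) \<partial>(lborel::'a measure))"
    and "M0 \<equiv> enn2real (\<integral>\<^sup>+u. ennreal (exp (- (lam / 4) * norm u ^ 2)) \<partial>(lborel::'a measure))"
    and "Q \<equiv> LINT y:S|lborel. q y powr (1 - \<epsilon>)"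
  shows "(\<integral>\<^sup>+x. ennreal (majorant x) \<partial>lborel) =
    ennreal ((real n * K) ^ p * (s ^ DIM('a) * s ^ (3 * p) * M1)
      + exp (- real n * (lam / 4) * \<rho> ^ 2) * (s ^ DIM('a) * M0) + exp (- real n * \<epsilon> * \<delta>) * Q)"
proof -
  have s: "s \<ge> 0" unfolding s_def by simp
  have M: "M1 \<ge> 0" "M0 \<ge> 0" unfolding M1_def M0_def by simp_all
  have "Q \<ge> 0" unfolding Q_def set_lebesgue_integral_def by (intro integral_nonneg_AE) simp
  have q_int': "integrable lborel (\<lambda>y. indicator S y * q y powr (1 - \<epsilon>))"
    using q_int unfolding set_integrable_def by simp
  then have [measurable]: "(\<lambda>y. indicator S y * q y powr (1 - \<epsilon>)) \<in> borel_measurable borel"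
    by (simp add: borel_measurable_integrable)
  have Q: "(\<integral>\<^sup>+x. ennreal (indicator S x * q x powr (1 - \<epsilon>)) \<partial>lborel) = ennreal Q"
    unfolding Q_def set_lebesgue_integral_def using q_int' by (subst nn_integral_eq_integral) auto
  let ?g1 = "\<lambda>x. norm (x - x0) ^ (3 * p) * exp (- (real n * (lam / 4)) * norm (x - x0) ^ 2)"
  let ?g2 = "\<lambda>x. norm (x - x0) ^ 0 * exp (- (real n * (lam / 4)) * norm (x - x0) ^ 2)"
  let ?g3 = "\<lambda>x. indicator S x * q x powr (1 - \<epsilon>)"
  have "(\<integral>\<^sup>+x. ennreal (majorant x) \<partial>lborel) = (\<integral>\<^sup>+x.
      ennreal ((real n * K) ^ p) * ennreal (?g1 x) + ennreal (exp (- real n * (lam / 4) * \<rho> ^ 2)) * ennreal (?g2 x)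
      + ennreal (exp (- real n * \<epsilon> * \<delta>)) * ennreal (?g3 x) \<partial>lborel)"
    unfolding majorant_def using K
    by (intro nn_integral_cong) (simp add: ennreal_plus ennreal_mult[symmetric] del: ennreal_plus_if)
  also have "\<dots> =
      ennreal ((real n * K) ^ p) * (\<integral>\<^sup>+x. ennreal (?g1 x) \<partial>lborel)
    + ennreal (exp (- real n * (lam / 4) * \<rho> ^ 2)) * (\<integral>\<^sup>+x. ennreal (?g2 x) \<partial>lborel)
    + ennreal (exp (- real n * \<epsilon> * \<delta>)) * (\<integral>\<^sup>+x. ennreal (?g3 x) \<partial>lborel)"
    by (simp add: nn_integral_add nn_integral_cmult)
  also have "\<dots> = ennreal ((real n * K) ^ p) * ennreal (s ^ DIM('a) * s ^ (3 * p) * M1)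
      + ennreal (exp (- real n * (lam / 4) * \<rho> ^ 2)) * ennreal (s ^ DIM('a) * s ^ 0 * M0)
      + ennreal (exp (- real n * \<epsilon> * \<delta>)) * ennreal Q"
    unfolding Q s_def M1_def M0_def using lam n
    by (simp only: nn_integral_gaussian_moment_rescale) simp
  finally show ?thesis using K s M \<open>Q \<ge> 0\<close> by (simp add: ennreal_plus ennreal_mult)
qed

lemma deviation_integral_le:
  defines "L \<equiv> density lborel (\<lambda>x. ennreal (gauss_weight x / (\<integral>y. gauss_weight y \<partial>lborel)))"
  shows "integrable L deviation \<and> (\<integral>x. deviation x \<partial>L) \<le> deviation_const * real n powr (- real p / 2)"
proof -
  define s where "s = 1 / sqrt (real n)"
  define M1 where "M1 = enn2real (\<integral>\<^sup>+u. ennreal (norm u ^ (3 * p) * exp (- (lam / 4) * norm u ^ 2)) \<partial>(lborel::'a measure))"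
  define M0 where "M0 = enn2real (\<integral>\<^sup>+u. ennreal (exp (- (lam / 4) * norm u ^ 2)) \<partial>(lborel::'a measure))"
  define c0 where "c0 = enn2real (\<integral>\<^sup>+u. ennreal (exp (- (Lam / 2) * norm u ^ 2)) \<partial>(lborel::'a measure))"
  define Q where "Q = (LINT y:S|lborel. q y powr (1 - \<epsilon>))"
  define e1 where "e1 = exp (- real n * (lam / 4) * \<rho> ^ 2)"
  define e2 where "e2 = exp (- real n * \<epsilon> * \<delta>)"
  define B where "B = (real n * K) ^ p * (s ^ DIM('a) * s ^ (3 * p) * M1) + e1 * (s ^ DIM('a) * M0) + e2 * Q"
  have s: "s > 0" "real n * s ^ 2 = 1" using n unfolding s_def by (auto simp: power_divide)
  have nonneg: "M1 \<ge> 0" "M0 \<ge> 0" "Q \<ge> 0" "e1 \<ge> 0" "e2 \<ge> 0"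
    unfolding M1_def M0_def Q_def e1_def e2_def set_lebesgue_integral_def
    by (auto intro!: integral_nonneg_AE)
  have c0: "c0 > 0" unfolding c0_def using Lam_pos by (intro nn_integral_gaussian_pos) simp
  have "gauss_weight x \<ge> 0" "deviation x \<ge> 0" for x
    unfolding gauss_weight_def deviation_def by simp_all
  have "(\<integral>\<^sup>+x. ennreal (gauss_weight x * deviation x) \<partial>lborel) \<le> (\<integral>\<^sup>+x. ennreal (majorant x) \<partial>lborel)"
    by (intro nn_integral_mono ennreal_leI deviation_le_majorant)
  also have "\<dots> = ennreal B"
    unfolding B_def s_def M1_def M0_def Q_def e1_def e2_def by (rule nn_integral_majorant)
  finally have int: "integrable L deviation \<and> (\<integral>x. deviation x \<partial>L) \<le> B / (s ^ DIM('a) * c0)"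
    unfolding L_def using normaliser_ge s c0 K nonneg \<open>gauss_weight _ \<ge> 0\<close> \<open>deviation _ \<ge> 0\<close>
    by (intro integrable_normalised_density_le) (auto simp: B_def s_def c0_def)
  have B_eq: "B / (s ^ DIM('a) * c0) = (K ^ p * s ^ p * M1 + e1 * M0 + e2 * Q / s ^ DIM('a)) / c0"
  proof -
    have "(real n * K) ^ p * s ^ (3 * p) = K ^ p * (real n * s ^ 2) ^ p * s ^ p"
      by (simp add: power_mult_distrib power_mult[symmetric] power_add[symmetric] mult_ac)
    then show ?thesis using s c0 unfolding B_def by (simp add: field_simps)
  qed
  have "K ^ p * s ^ p * M1 + e1 * M0 + e2 * Q / s ^ DIM('a) \<le> deviation_const * c0 * real n powr (- real p / 2)"
    using laplace_error_terms_le_powr[OF n, of "lam / 4 * \<rho> ^ 2" "\<epsilon> * \<delta>" M1 M0 Q K p "DIM('a)"]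
      lam \<rho> \<epsilon> \<delta> nonneg K c0
    unfolding deviation_const_def s_def e1_def e2_def M1_def M0_def Q_def c0_def
    by (simp add: mult.assoc)
  then have "B / (s ^ DIM('a) * c0) \<le> deviation_const * real n powr (- real p / 2)"
    unfolding B_eq using c0 by (simp add: pos_divide_le_eq mult_ac)
  with int show ?thesis by linarith
qed

end

section \<open>Uniformity in n\<close>

lemma laplace_deviation_bigo:
  fixes S :: "'a::euclidean_space set" and I f :: "nat \<Rightarrow> 'a \<Rightarrow> real" and x :: "nat \<Rightarrow> 'a"
    and A :: "nat \<Rightarrow> 'a \<Rightarrow>\<^sub>L 'a \<Rightarrow>\<^sub>L real" and q :: "'a \<Rightarrow> real"
  assumes p: "p \<ge> 1" and open_S: "open S" and lam: "lam > 0" and \<rho>: "\<rho> > 0"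
    and K: "K \<ge> 0" "K * \<rho> \<le> lam / 4" and \<delta>: "\<delta> > 0" and \<epsilon>: "0 < \<epsilon>" "\<epsilon> < 1"
    and q_int: "set_integrable lborel S (\<lambda>y. q y powr (1 - \<epsilon>))"
    and ev: "\<forall>\<^sub>F n in sequentially. continuous_on S (I n)
      \<and> (\<forall>v. lam * norm v ^ 2 \<le> A n v v \<and> A n v v \<le> Lam * norm v ^ 2)
      \<and> (\<forall>h. norm h < \<rho> \<longrightarrow> x n + h \<in> S \<and> \<bar>I n (x n + h) - A n h h / 2\<bar> \<le> K * norm h ^ 3)
      \<and> (\<forall>y\<in>S. \<rho> \<le> norm (y - x n) \<longrightarrow> \<delta> \<le> I n y)
      \<and> (\<forall>y\<in>S. exp (- real n * I n y) \<le> q y)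
      \<and> (\<forall>y. f n y = (if y \<in> S then exp (- real n * I n y) else 0))"
  defines "L \<equiv> \<lambda>n. density lborel (\<lambda>y. ennreal (exp (- (real n / 2) * A n (y - x n) (y - x n)) /
      (\<integral>z. exp (- (real n / 2) * A n (z - x n) (z - x n)) \<partial>lborel)))"
    and "g \<equiv> \<lambda>n y. \<bar>(f n y / exp (- (real n / 2) * A n (y - x n) (y - x n))) powr (1 / real p) - 1\<bar> ^ p"
  shows "(\<forall>\<^sub>F n in sequentially. integrable (L n) (g n))
    \<and> (\<lambda>n. \<integral>y. g n y \<partial>L n) \<in> O(\<lambda>n. real n powr (- real p / 2))"
proof -
  define C where "C = laplace_step.deviation_const S q p lam Lam \<rho> K \<delta> \<epsilon>"
  have bound: "\<forall>\<^sub>F n in sequentially.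
      integrable (L n) (g n) \<and> (\<integral>y. g n y \<partial>L n) \<le> C * real n powr (- real p / 2)"
    using ev eventually_ge_at_top[of 1]
  proof eventually_elim
    case (elim n)
    interpret step: laplace_step S "I n" "x n" "A n" q n p lam Lam \<rho> K \<delta> \<epsilon>
      using elim p open_S lam \<rho> K \<delta> \<epsilon> q_int by unfold_locales auto
    have "g n = step.deviation"
      using elim unfolding g_def step.deviation_def step.target_def step.gauss_weight_def by auto
    then show ?case
      using step.deviation_integral_le unfolding L_def C_def step.gauss_weight_def by simp
  qed
  have "(\<lambda>n. \<integral>y. g n y \<partial>L n) \<in> O(\<lambda>n. real n powr (- real p / 2))"
  proof (rule bigoI[where c = C])
    show "\<forall>\<^sub>F n in at_top. norm (\<integral>y. g n y \<partial>L n) \<le> C * norm (real n powr (- real p / 2))"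
      using bound by eventually_elim (auto simp: g_def)
  qed
  with bound show ?thesis by (auto elim: eventually_mono)
qed

lemma eventually_norm_diff_inverse_scaleR_le:
  fixes a :: "nat \<Rightarrow> 'a \<Rightarrow> 'b::real_normed_vector" and b :: "'a \<Rightarrow> 'b"
  assumes "\<forall>n \<ge> N. \<forall>y\<in>T. norm (b y) \<le> K \<and> norm (a n y) \<le> K"
  shows "\<forall>\<^sub>F n in sequentially. \<forall>y\<in>T. norm (a n y - (1 / real n) *\<^sub>R b y) \<le> 2 * K"
  using eventually_ge_at_top[of "max 1 N"]
proof eventually_elim
  case (elim n)
  show ?case
  proof
    fix y assume "y \<in> T"
    then have "norm (b y) \<le> K" "norm (a n y) \<le> K" using assms elim by auto
    moreover have "norm ((1 / real n) *\<^sub>R b y) \<le> 1 * norm (b y)"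
      using elim by (simp only: norm_scaleR) (intro mult_right_mono, auto)
    ultimately show "norm (a n y - (1 / real n) *\<^sub>R b y) \<le> 2 * K"
      using norm_triangle_ineq4[of "a n y" "(1 / real n) *\<^sub>R b y"] by linarith
  qed
qed

lemma eventually_norm_Dfr3_log_potential_le:
  fixes \<Phi> :: "nat \<Rightarrow> 'a::real_normed_vector \<Rightarrow> real" and \<pi> :: "'a \<Rightarrow> real"
  assumes \<Phi>: "\<And>n. n \<ge> 1 \<Longrightarrow> C3_on S (\<Phi> n)" and \<pi>: "C3_on S \<pi>" "\<And>y. y \<in> S \<Longrightarrow> \<pi> y > 0"
    and K: "\<forall>n \<ge> N. \<forall>y\<in>S. norm y \<le> r \<longrightarrow>
      norm (Dfr (Dfr (Dfr (\<lambda>z. ln (\<pi> z)))) y) \<le> K \<and> norm (Dfr (Dfr (Dfr (\<Phi> n))) y) \<le> K"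
  shows "\<forall>\<^sub>F n in sequentially. \<forall>y\<in>S. norm y \<le> r \<longrightarrow>
    norm (Dfr (Dfr (Dfr (\<lambda>z. \<Phi> n z - (1 / real n) * ln (\<pi> z)))) y) \<le> 2 * K"
proof -
  have "\<forall>\<^sub>F n in sequentially. \<forall>y\<in>{y \<in> S. norm y \<le> r}.
      norm (Dfr (Dfr (Dfr (\<Phi> n))) y - (1 / real n) *\<^sub>R Dfr (Dfr (Dfr (\<lambda>z. ln (\<pi> z)))) y) \<le> 2 * K"
    using K by (intro eventually_norm_diff_inverse_scaleR_le) auto
  then show ?thesis
    using eventually_ge_at_top[of 1]
  proof eventually_elim
    case (elim n)
    show ?case
    proof (intro ballI impI)
      fix y assume y: "y \<in> S" "norm y \<le> r"
      have n: "n \<ge> 1" using elim(2) by simp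
      have "Dfr (Dfr (Dfr (\<lambda>z. \<Phi> n z - (1 / real n) * ln (\<pi> z)))) y =
          Dfr (Dfr (Dfr (\<Phi> n))) y - (1 / real n) *\<^sub>R Dfr (Dfr (Dfr (\<lambda>z. ln (\<pi> z)))) y"
        by (rule thrice_differentiable_on_log_potential(3)[OF \<Phi>[OF n] \<pi> y(1)])
      then show "norm (Dfr (Dfr (Dfr (\<lambda>z. \<Phi> n z - (1 / real n) * ln (\<pi> z)))) y) \<le> 2 * K"
        using elim(1) y by simp
    qed
  qed
qed

lemma tendsto_diff_inverse_scaleR:
  fixes G F :: "nat \<Rightarrow> 'b::real_normed_vector" and L :: "'a::t2_space \<Rightarrow> 'b"
  assumes "G \<longlonglongrightarrow> H" "x \<longlonglongrightarrow> x_lim" "isCont L x_lim"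
    and "\<forall>\<^sub>F n in sequentially. F n = G n - (1 / real n) *\<^sub>R L (x n)"
  shows "F \<longlonglongrightarrow> H"
proof -
  have "(\<lambda>n. (1 / real n) *\<^sub>R L (x n)) \<longlonglongrightarrow> 0"
    using tendsto_scaleR[OF lim_inverse_n' isCont_tendsto_compose[OF assms(3,2)]] by simp
  from tendsto_diff[OF assms(1) this] show ?thesis
    using assms(4) by (simp add: Lim_transform_eventually eventually_mono)
qed

lemma pos_def_form_coercive:
  fixes H :: "'a::euclidean_space \<Rightarrow>\<^sub>L 'a \<Rightarrow>\<^sub>L real"
  assumes "pos_def_form H"
  obtains c where "c > 0" "\<And>v. H v v \<ge> c * norm v ^ 2"
proof -
  have cont: "continuous_on (sphere 0 1) (\<lambda>v. H v v)"
    by (intro blinfun.continuous_on continuous_on_id continuous_on_const)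
  obtain b :: 'a where "b \<in> Basis" using nonempty_Basis by blast
  then have "sphere (0::'a) 1 \<noteq> {}" by (auto simp: norm_Basis)
  then obtain v0 where v0: "v0 \<in> sphere 0 1" "\<And>y. y \<in> sphere 0 1 \<Longrightarrow> H v0 v0 \<le> H y y"
    using continuous_attains_inf[OF compact_sphere _ cont] by blast
  have "H v0 v0 > 0"
    using assms v0(1) unfolding pos_def_form_def by (metis norm_zero zero_neq_one mem_sphere_0)
  moreover have "H v v \<ge> H v0 v0 * norm v ^ 2" for v
  proof (cases "v = 0")
    case False
    then have "H v0 v0 \<le> H (v /\<^sub>R norm v) (v /\<^sub>R norm v)" by (intro v0(2)) simp
    also have "\<dots> = H v v / (norm v)^2"
      by (simp add: blinfun.scaleR_left blinfun.scaleR_right power2_eq_square divide_inverse)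
    finally show ?thesis using False by (simp add: pos_le_divide_eq)
  qed (simp add: blinfun.zero_left blinfun.zero_right)
  ultimately show ?thesis using that by blast
qed

lemma eventually_quadratic_form_bounds:
  fixes A :: "nat \<Rightarrow> 'a::euclidean_space \<Rightarrow>\<^sub>L 'a \<Rightarrow>\<^sub>L real"
  assumes "A \<longlonglongrightarrow> H" "pos_def_form H"
  obtains lam Lam where "lam > 0"
    "\<forall>\<^sub>F n in sequentially. \<forall>v. lam * norm v ^ 2 \<le> A n v v \<and> A n v v \<le> Lam * norm v ^ 2"
proof -
  obtain c where c: "c > 0" "\<And>v. H v v \<ge> c * norm v ^ 2"
    using pos_def_form_coercive[OF assms(2)] by blast
  have "\<forall>\<^sub>F n in sequentially. norm (A n - H) < c / 2"
    using assms(1) c(1) unfolding tendsto_iff dist_norm by (meson half_gt_zero)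
  then have "\<forall>\<^sub>F n in sequentially. \<forall>v. c / 2 * norm v ^ 2 \<le> A n v v \<and> A n v v \<le> (norm H + c / 2) * norm v ^ 2"
  proof eventually_elim
    case (elim n)
    show ?case
    proof
      fix v
      have "A n v v = H v v + (A n - H) v v" by (simp add: blinfun.diff_left)
      moreover have "\<bar>(A n - H) v v\<bar> \<le> c / 2 * norm v ^ 2"
        using norm_blinfun_apply2_le[of "A n - H" v] elim by (smt (verit) mult_right_mono zero_le_power2)
      moreover have "H v v \<le> norm H * norm v ^ 2" using norm_blinfun_apply2_le[of H v] by linarith
      ultimately show "c / 2 * norm v ^ 2 \<le> A n v v \<and> A n v v \<le> (norm H + c / 2) * norm v ^ 2"
        using c(2)[of v] unfolding distrib_right abs_le_iff by linarith
    qed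
  qed
  then show ?thesis using that c(1) by (meson half_gt_zero)
qed

lemma add_mem_ball_norm_le:
  fixes x c h :: "'a::real_normed_vector"
  assumes "dist x c < r / 2" "norm h < r / 2"
  shows "x + h \<in> ball c r" "norm (x + h) \<le> norm c + r"
proof -
  have "norm (x + h - c) \<le> norm (x - c) + norm h"
    using norm_triangle_ineq[of "x - c" h] by (simp add: algebra_simps)
  then have d: "norm (x + h - c) < r" using assms by (simp add: dist_norm)
  then show "x + h \<in> ball c r" by (simp add: dist_norm norm_minus_commute)
  show "norm (x + h) \<le> norm c + r"
    using norm_triangle_ineq[of c "x + h - c"] d by simp
qed

lemma eventually_cubic_taylor_bound:
  fixes I :: "nat \<Rightarrow> 'a::real_normed_vector \<Rightarrow> real" and x :: "nat \<Rightarrow> 'a"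
  assumes S: "open S" "x_lim \<in> S" and x: "x \<longlonglongrightarrow> x_lim" and c: "c > 0"
    and smooth: "\<forall>\<^sub>F n in sequentially.
      thrice_differentiable_on S (I n) \<and> I n (x n) = 0 \<and> Dfr (I n) (x n) = 0"
    and third: "\<And>r. r > 0 \<Longrightarrow> \<exists>K. \<forall>\<^sub>F n in sequentially.
      \<forall>y\<in>S. norm y \<le> r \<longrightarrow> norm (Dfr (Dfr (Dfr (I n))) y) \<le> K"
  obtains \<rho> K where "\<rho> > 0" "K \<ge> 0" "K * \<rho> \<le> c"
    "\<forall>\<^sub>F n in sequentially. \<forall>h. norm h < \<rho> \<longrightarrow>
       x n + h \<in> S \<and> \<bar>I n (x n + h) - Dfr (Dfr (I n)) (x n) h h / 2\<bar> \<le> K * norm h ^ 3"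
proof -
  obtain \<rho>0 where \<rho>0: "\<rho>0 > 0" "ball x_lim \<rho>0 \<subseteq> S" using S by (rule openE)
  have "norm x_lim + \<rho>0 > 0" using \<rho>0(1) by (simp add: add_nonneg_pos)
  then obtain K1 where K1: "\<forall>\<^sub>F n in sequentially. \<forall>y\<in>S. norm y \<le> norm x_lim + \<rho>0 \<longrightarrow>
      norm (Dfr (Dfr (Dfr (I n))) y) \<le> K1"
    using third by blast
  define K where "K = \<bar>K1\<bar>"
  define \<rho> where "\<rho> = min (\<rho>0 / 2) (c / (K + 1))"
  have K: "K \<ge> 0" unfolding K_def by simp
  have \<rho>_pos: "\<rho> > 0" unfolding \<rho>_def using \<rho>0 c K by simp
  have \<rho>_le: "\<rho> \<le> \<rho>0 / 2" unfolding \<rho>_def by (rule min.cobounded1)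
  have "K * \<rho> \<le> K * (c / (K + 1))" unfolding \<rho>_def using K by (intro mult_left_mono) auto
  also have "\<dots> \<le> c" using K c by (simp add: field_simps)
  finally have K\<rho>: "K * \<rho> \<le> c" .
  have "\<forall>\<^sub>F n in sequentially. dist (x n) x_lim < \<rho>0 / 2"
    using x \<rho>0(1) unfolding tendsto_iff by (meson half_gt_zero)
  with smooth K1 have "\<forall>\<^sub>F n in sequentially. \<forall>h. norm h < \<rho> \<longrightarrow>
      x n + h \<in> S \<and> \<bar>I n (x n + h) - Dfr (Dfr (I n)) (x n) h h / 2\<bar> \<le> K * norm h ^ 3"
  proof eventually_elim
    case (elim n)
    have seg: "x n + h \<in> S \<and> norm (x n + h) \<le> norm x_lim + \<rho>0" if "norm h < \<rho>0 / 2" for h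
      using add_mem_ball_norm_le[OF elim(3) that] \<rho>0(2) by blast
    show ?case
    proof (intro allI impI conjI)
      fix h :: 'a assume h: "norm h < \<rho>"
      then show "x n + h \<in> S" using seg \<rho>_le by simp
      have th: "norm (t *\<^sub>R h) < \<rho>0 / 2" if "0 \<le> t" "t \<le> 1" for t
        using that h \<rho>_le mult_left_le_one_le[of "norm h" t] by simp
      have "\<bar>I n (x n + h) - I n (x n) - Dfr (I n) (x n) h - Dfr (Dfr (I n)) (x n) h h / 2\<bar>
          \<le> K * norm h ^ 3 / 6"
      proof (rule third_order_taylor_bound)
        show "thrice_differentiable_on S (I n)" using elim(1) by blast
        show "x n + t *\<^sub>R h \<in> S" if "0 \<le> t" "t \<le> 1" for t using seg[OF th[OF that]] by blast
        show "norm (Dfr (Dfr (Dfr (I n))) (x n + t *\<^sub>R h)) \<le> K" if "0 \<le> t" "t \<le> 1" for t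
          using seg[OF th[OF that]] elim(2) unfolding K_def by force
      qed
      then show "\<bar>I n (x n + h) - Dfr (Dfr (I n)) (x n) h h / 2\<bar> \<le> K * norm h ^ 3"
        using elim(1) mult_nonneg_nonneg[OF K, of "norm h ^ 3"] by simp
    qed
  qed
  with \<rho>_pos K K\<rho> that show ?thesis by blast
qed

lemma laplace_deviation_bigo_smooth:
  fixes S :: "'a::euclidean_space set" and I f :: "nat \<Rightarrow> 'a \<Rightarrow> real" and x :: "nat \<Rightarrow> 'a"
    and H :: "'a \<Rightarrow>\<^sub>L 'a \<Rightarrow>\<^sub>L real" and q :: "'a \<Rightarrow> real"
  assumes p: "p \<ge> 1" and S: "open S" "x_lim \<in> S" and x: "x \<longlonglongrightarrow> x_lim"
    and smooth: "\<forall>\<^sub>F n in sequentially.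
      thrice_differentiable_on S (I n) \<and> I n (x n) = 0 \<and> Dfr (I n) (x n) = 0"
    and hessian: "(\<lambda>n. Dfr (Dfr (I n)) (x n)) \<longlonglongrightarrow> H" "pos_def_form H"
    and third: "\<And>r. r > 0 \<Longrightarrow> \<exists>K. \<forall>\<^sub>F n in sequentially.
      \<forall>y\<in>S. norm y \<le> r \<longrightarrow> norm (Dfr (Dfr (Dfr (I n))) y) \<le> K"
    and tail: "\<And>r. r > 0 \<Longrightarrow> \<exists>\<delta>>0. \<forall>\<^sub>F n in sequentially.
      \<forall>y\<in>S. r < norm (y - x n) \<longrightarrow> \<delta> \<le> I n y"
    and \<epsilon>: "0 < \<epsilon>" "\<epsilon> < 1" and q_int: "set_integrable lborel S (\<lambda>y. q y powr (1 - \<epsilon>))"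
    and q_bound: "\<forall>\<^sub>F n in sequentially. \<forall>y\<in>S. exp (- real n * I n y) \<le> q y"
    and f: "\<forall>\<^sub>F n in sequentially. \<forall>y. f n y = (if y \<in> S then exp (- real n * I n y) else 0)"
  defines "A \<equiv> \<lambda>n. Dfr (Dfr (I n)) (x n)"
  shows "(\<forall>\<^sub>F n in sequentially. integrable
        (density lborel (\<lambda>y. ennreal (exp (- (real n / 2) * A n (y - x n) (y - x n)) /
          (\<integral>z. exp (- (real n / 2) * A n (z - x n) (z - x n)) \<partial>lborel))))
        (\<lambda>y. \<bar>(f n y / exp (- (real n / 2) * A n (y - x n) (y - x n))) powr (1 / real p) - 1\<bar> ^ p))
    \<and> (\<lambda>n. \<integral>y. \<bar>(f n y / exp (- (real n / 2) * A n (y - x n) (y - x n))) powr (1 / real p) - 1\<bar> ^ p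
        \<partial>density lborel (\<lambda>y. ennreal (exp (- (real n / 2) * A n (y - x n) (y - x n)) /
          (\<integral>z. exp (- (real n / 2) * A n (z - x n) (z - x n)) \<partial>lborel))))
      \<in> O(\<lambda>n. real n powr (- real p / 2))"
proof -
  obtain lam Lam where lam: "lam > 0" and A_bounds:
    "\<forall>\<^sub>F n in sequentially. \<forall>v. lam * norm v ^ 2 \<le> A n v v \<and> A n v v \<le> Lam * norm v ^ 2"
    using eventually_quadratic_form_bounds[OF hessian] unfolding A_def by blast
  have "lam / 4 > 0" using lam by simp
  from eventually_cubic_taylor_bound[OF S x this smooth third]
  obtain \<rho> K where \<rho>: "\<rho> > 0" and K: "K \<ge> 0" "K * \<rho> \<le> lam / 4" and taylor:
    "\<forall>\<^sub>F n in sequentially. \<forall>h. norm h < \<rho> \<longrightarrow>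
       x n + h \<in> S \<and> \<bar>I n (x n + h) - A n h h / 2\<bar> \<le> K * norm h ^ 3"
    unfolding A_def by blast
  obtain \<delta> where \<delta>: "\<delta> > 0"
    and tail_\<rho>: "\<forall>\<^sub>F n in sequentially. \<forall>y\<in>S. \<rho> / 2 < norm (y - x n) \<longrightarrow> \<delta> \<le> I n y"
    using tail[of "\<rho> / 2"] \<rho> by auto
  show ?thesis
  proof (rule laplace_deviation_bigo[OF p S(1) lam \<rho> K \<delta> \<epsilon> q_int])
    show "\<forall>\<^sub>F n in sequentially. continuous_on S (I n)
      \<and> (\<forall>v. lam * norm v ^ 2 \<le> A n v v \<and> A n v v \<le> Lam * norm v ^ 2)
      \<and> (\<forall>h. norm h < \<rho> \<longrightarrow> x n + h \<in> S \<and> \<bar>I n (x n + h) - A n h h / 2\<bar> \<le> K * norm h ^ 3)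
      \<and> (\<forall>y\<in>S. \<rho> \<le> norm (y - x n) \<longrightarrow> \<delta> \<le> I n y)
      \<and> (\<forall>y\<in>S. exp (- real n * I n y) \<le> q y)
      \<and> (\<forall>y. f n y = (if y \<in> S then exp (- real n * I n y) else 0))"
      using smooth A_bounds taylor tail_\<rho> q_bound f
    proof eventually_elim
      case (elim n)
      then show ?case using \<rho> by (force intro: thrice_differentiable_on_imp_continuous_on)
    qed
  qed
qed

theorem lemma1:
  fixes \<pi>0 :: "real^'d \<Rightarrow> real"
    and S0 :: "(real^'d) set"
    and \<Phi> :: "nat \<Rightarrow> real^'d \<Rightarrow> real"
    and I :: "nat \<Rightarrow> real^'d \<Rightarrow> real"
    and xn :: "nat \<Rightarrow> real^'d"
    and p :: nat
  assumes dens_meas: "\<pi>0 \<in> borel_measurable lborel"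
    and dens_nonneg: "\<And>x. \<pi>0 x \<ge> 0"
    and dens_prob: "(\<integral>\<^sup>+ x. ennreal (\<pi>0 x) \<partial>lborel) = 1"
    and S0_def: "S0 = {x. \<pi>0 x > 0}"
    and Z_pos: "\<And>n. n \<ge> 1 \<Longrightarrow> 0 < (\<integral>\<^sup>+ x \<in> S0. ennreal (exp (- real n * \<Phi> n x) * \<pi>0 x) \<partial>lborel)"
    and Z_fin: "\<And>n. n \<ge> 1 \<Longrightarrow> (\<integral>\<^sup>+ x \<in> S0. ennreal (exp (- real n * \<Phi> n x) * \<pi>0 x) \<partial>lborel) < \<infinity>"
    and I_def: "\<And>n x. I n x = \<Phi> n x - (1 / real n) * ln (\<pi>0 x)"
    \<comment> \<open>(A1)\<close>
    and A1_C2_Phi: "\<And>n. n \<ge> 1 \<Longrightarrow> C2_on S0 (\<Phi> n)"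
    and A1_C2_pi0: "C2_on S0 \<pi>0"
    and A1_xn_in: "\<And>n. n \<ge> 1 \<Longrightarrow> xn n \<in> S0"
    and A1_min: "\<And>n y. n \<ge> 1 \<Longrightarrow> y \<in> S0 \<Longrightarrow> I n (xn n) \<le> I n y"
    and A1_unique: "\<And>n y. n \<ge> 1 \<Longrightarrow> y \<in> S0 \<Longrightarrow> I n y = I n (xn n) \<Longrightarrow> y = xn n"
    and A1_zero: "\<And>n. n \<ge> 1 \<Longrightarrow> I n (xn n) = 0"
    and A1_grad: "\<And>n. n \<ge> 1 \<Longrightarrow> Dfr (I n) (xn n) = 0"
    and A1_hess: "\<And>n. n \<ge> 1 \<Longrightarrow> pos_def_form (Dfr (Dfr (I n)) (xn n))"
    \<comment> \<open>(A2)\<close>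
    and A2_C3_Phi: "\<And>n. n \<ge> 1 \<Longrightarrow> C3_on S0 (\<Phi> n)"
    and A2_C3_pi0: "C3_on S0 \<pi>0"
    and A2_i_x: "\<exists>xs\<in>S0. xn \<longlonglongrightarrow> xs"
    and A2_i_H: "\<exists>H. (\<lambda>n. Dfr (Dfr (\<Phi> n)) (xn n)) \<longlonglongrightarrow> H \<and> pos_def_form H"
    and A2_ii: "\<And>r. r > 0 \<Longrightarrow> \<exists>nr \<ge> 1. \<exists>\<delta> > 0. \<exists>K. \<forall>n \<ge> nr.
         (\<forall>y\<in>S0. norm (y - xn n) > r \<longrightarrow> I n y \<ge> \<delta>) \<and>
         (\<forall>y\<in>S0. norm y \<le> r \<longrightarrow>
             norm (Dfr (Dfr (Dfr (\<lambda>z. ln (\<pi>0 z)))) y) \<le> K \<and> norm (Dfr (Dfr (Dfr (\<Phi> n))) y) \<le> K)"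
    and A2_iii: "\<exists>n0 \<ge> 1. \<exists>\<epsilon> q. 0 < \<epsilon> \<and> \<epsilon> < 1 \<and> (\<forall>y\<in>S0. q y \<ge> 0) \<and>
         (\<forall>n \<ge> n0. \<forall>y\<in>S0. exp (- real n * I n y) \<le> q y) \<and>
         set_integrable lborel S0 (\<lambda>y. q y powr (1 - \<epsilon>))"
    and p_pos: "p \<ge> 1"
  shows
    "let \<pi>n = (\<lambda>n x. if x \<in> S0 then exp (- real n * \<Phi> n x) * \<pi>0 x else 0);
         \<pi>t = (\<lambda>n x. exp (- (real n / 2) * blinfun_apply (blinfun_apply (Dfr (Dfr (I n)) (xn n)) (x - xn n)) (x - xn n)));
         L = (\<lambda>n. density lborel (\<lambda>x. ennreal (\<pi>t n x / (\<integral>y. \<pi>t n y \<partial>lborel))));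
         g = (\<lambda>n x. \<bar>(\<pi>n n x / \<pi>t n x) powr (1 / real p) - 1\<bar> ^ p)
     in (\<forall>\<^sub>F n in at_top. integrable (L n) (g n)) \<and>
        (\<lambda>n. \<integral>x. g n x \<partial>(L n)) \<in> O(\<lambda>n. real n powr (- real p / 2))"
proof -
  have open_S0: "open S0" using A1_C2_pi0 unfolding C2_on_def by blast
  have \<pi>0_pos: "\<And>y. y \<in> S0 \<Longrightarrow> \<pi>0 y > 0" using S0_def by auto
  have I_eq: "I n = (\<lambda>z. \<Phi> n z - (1 / real n) * ln (\<pi>0 z))" for n by (simp add: fun_eq_iff I_def)
  have I_smooth: "thrice_differentiable_on S0 (I n)"
      "\<And>y. y \<in> S0 \<Longrightarrow> Dfr (Dfr (I n)) y =
        Dfr (Dfr (\<Phi> n)) y - (1 / real n) *\<^sub>R Dfr (Dfr (\<lambda>z. ln (\<pi>0 z))) y"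
    if "n \<ge> 1" for n
    using thrice_differentiable_on_log_potential[OF A2_C3_Phi[OF that] A2_C3_pi0 \<pi>0_pos]
    unfolding I_eq by blast+
  have ln_\<pi>0: "thrice_differentiable_on S0 (\<lambda>z. ln (\<pi>0 z))"
    by (intro thrice_differentiable_on_ln C3_on_imp_thrice_differentiable_on A2_C3_pi0 \<pi>0_pos)
  obtain x_star where x_star: "x_star \<in> S0" "xn \<longlonglongrightarrow> x_star" using A2_i_x by blast
  obtain H where H: "(\<lambda>n. Dfr (Dfr (\<Phi> n)) (xn n)) \<longlonglongrightarrow> H" "pos_def_form H" using A2_i_H by blast
  have hessian: "(\<lambda>n. Dfr (Dfr (I n)) (xn n)) \<longlonglongrightarrow> H"
  proof (rule tendsto_diff_inverse_scaleR[OF H(1) x_star(2) thrice_differentiable_on_isCont_Dfr2[OF ln_\<pi>0 x_star(1)]])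
    show "\<forall>\<^sub>F n in sequentially. Dfr (Dfr (I n)) (xn n) =
        Dfr (Dfr (\<Phi> n)) (xn n) - (1 / real n) *\<^sub>R Dfr (Dfr (\<lambda>z. ln (\<pi>0 z))) (xn n)"
      using eventually_ge_at_top[of 1] by eventually_elim (simp add: I_smooth(2) A1_xn_in)
  qed
  have third: "\<exists>K. \<forall>\<^sub>F n in sequentially.
      \<forall>y\<in>S0. norm y \<le> r \<longrightarrow> norm (Dfr (Dfr (Dfr (I n))) y) \<le> K" if r: "r > 0" for r
  proof -
    obtain nr K where "\<forall>n \<ge> nr. \<forall>y\<in>S0. norm y \<le> r \<longrightarrow>
        norm (Dfr (Dfr (Dfr (\<lambda>z. ln (\<pi>0 z)))) y) \<le> K \<and> norm (Dfr (Dfr (Dfr (\<Phi> n))) y) \<le> K"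
      using A2_ii[OF r] by blast
    from eventually_norm_Dfr3_log_potential_le[OF A2_C3_Phi A2_C3_pi0 \<pi>0_pos this]
    show ?thesis unfolding I_eq by blast
  qed
  have tail: "\<exists>\<delta>>0. \<forall>\<^sub>F n in sequentially. \<forall>y\<in>S0. r < norm (y - xn n) \<longrightarrow> \<delta> \<le> I n y"
    if "r > 0" for r
    using A2_ii[OF that] unfolding eventually_sequentially by blast
  obtain nq \<epsilon> q where \<epsilon>: "0 < \<epsilon>" "\<epsilon> < 1"
    and q_bound: "\<forall>n \<ge> nq. \<forall>y\<in>S0. exp (- real n * I n y) \<le> q y"
    and q_int: "set_integrable lborel S0 (\<lambda>y. q y powr (1 - \<epsilon>))"
    using A2_iii by blast
  have target: "(if y \<in> S0 then exp (- real n * \<Phi> n y) * \<pi>0 y else 0) =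
      (if y \<in> S0 then exp (- real n * I n y) else 0)" if "n \<ge> 1" for n y
  proof (cases "y \<in> S0")
    case True
    have "- real n * I n y = - real n * \<Phi> n y + ln (\<pi>0 y)"
      using that unfolding I_def by (simp add: algebra_simps)
    then show ?thesis using True \<pi>0_pos by (simp add: exp_diff exp_minus divide_inverse)
  qed simp
  show ?thesis
    unfolding Let_def
  proof (rule laplace_deviation_bigo_smooth[OF p_pos open_S0 x_star _ hessian H(2) third tail \<epsilon> q_int])
    show "\<forall>\<^sub>F n in sequentially.
        thrice_differentiable_on S0 (I n) \<and> I n (xn n) = 0 \<and> Dfr (I n) (xn n) = 0"
      using eventually_ge_at_top[of 1] by eventually_elim (simp add: I_smooth(1) A1_zero A1_grad)
    show "\<forall>\<^sub>F n in sequentially. \<forall>y\<in>S0. exp (- real n * I n y) \<le> q y"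
      using q_bound unfolding eventually_sequentially by blast
    show "\<forall>\<^sub>F n in sequentially. \<forall>y. (if y \<in> S0 then exp (- real n * \<Phi> n y) * \<pi>0 y else 0) =
        (if y \<in> S0 then exp (- real n * I n y) else 0)"
      using eventually_ge_at_top[of 1] by eventually_elim (intro allI target)
  qed
qed

end
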